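(* Let $\mathbf{x}\in L^2(\mathbb{R})$, let $k\in\mathbb{Q}^+$ and let $\theta\in\mathbb{R}$ with $\theta\notin\pi\mathbb{Z}$. Then the two-dimensional Fourier transform of the new fractional ambiguity function of $\mathbf{x}$ gives its fractional scaled Wigner distribution: for $t,u\in\mathbb{R}$, $$\int_{\mathbb{R}^2}\mathcal{A}^{\theta,k}_{\mathbf{x}}(\tau,z)\,e^{i(z t-u\tau)\csc\theta}\,dz\,d\tau=\frac{1}{|\Omega_\theta|^2}\,[FrSWD]^{\theta,k}_{\mathbf{x}}(t,u).$$
   Context: Superscript $*$ denotes complex conjugation. $\Omega_\theta=\sqrt{(1-i\cot\theta)/2\pi}$, so $|\Omega_\theta|^2=|\csc\theta|/(2\pi)$. The new fractional ambiguity function (NFrAF) of $\mathbf{x}\in L^2(\mathbb{R})$ with parameters $(\theta,k)$ is $$\mathcal{A}^{\theta,k}_{\mathbf{x}}(\tau,u)=|\Omega_\theta|^2\int_{\mathbb{R}}\mathbf{x}\left(t+k\tfrac{\tau}{2}\right)\mathbf{x}^*\left(t-k\tfrac{\tau}{2}\right)e^{it(k\tau\cot\theta-u\csc\theta)}\,dt.$$ The fractional scaled Wigner distribution (FrSWD) is $$[FrSWD]^{\theta,k}_{\mathbf{x}}(t,u)=|\Omega_\theta|^2\int_{\mathbb{R}}\mathbf{x}\left(t+k\tfrac{\tau}{2}\right)\mathbf{x}^*\left(t-k\tfrac{\tau}{2}\right)e^{i\tau(kt\cot\theta-u\csc\theta)}\,d\tau.$$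
   Formalization: The integral over R^2 need not converge absolutely for x in L^2 (e.g. x the indicator of [0,1]); the identity is proved for all x as an L^2 limit of integrals over [-R,R]^2, and for every t,u whenever the ambiguity function is integrable on R^2. *)

theory Defs
  imports "HOL-Analysis.Analysis"
begin

definition csc :: "real \<Rightarrow> real" where
  "csc \<theta> = 1 / sin \<theta>"

definition Omega :: "real \<Rightarrow> complex" where
  "Omega \<theta> = csqrt ((1 - \<i> * of_real (cot \<theta>)) / of_real (2 * pi))"

(* Square-integrable Lebesgue measurable functions; functions that agree almost everywhere
   are not identified. *)
definition L2 :: "('a::euclidean_space \<Rightarrow> complex) set" where
  "L2 = {f. f \<in> borel_measurable lebesgue \<and> integrable lebesgue (\<lambda>s. (norm (f s))\<^sup>2)}"

(* New fractional ambiguity function. *)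
definition NFrAF :: "real \<Rightarrow> real \<Rightarrow> (real \<Rightarrow> complex) \<Rightarrow> real \<Rightarrow> real \<Rightarrow> complex" where
  "NFrAF \<theta> k x \<tau> u =
     of_real ((norm (Omega \<theta>))\<^sup>2) *
     (LINT t|lebesgue. x (t + k * \<tau> / 2) * cnj (x (t - k * \<tau> / 2)) *
        exp (\<i> * of_real (t * (k * \<tau> * cot \<theta> - u * csc \<theta>))))"

(* Fractional scaled Wigner distribution. *)
definition FrSWD :: "real \<Rightarrow> real \<Rightarrow> (real \<Rightarrow> complex) \<Rightarrow> real \<Rightarrow> real \<Rightarrow> complex" where
  "FrSWD \<theta> k x t u =
     of_real ((norm (Omega \<theta>))\<^sup>2) *
     (LINT \<tau>|lebesgue. x (t + k * \<tau> / 2) * cnj (x (t - k * \<tau> / 2)) *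
        exp (\<i> * of_real (\<tau> * (k * t * cot \<theta> - u * csc \<theta>))))"

(* The two-dimensional Fourier integral of f, restricted to a region S of the
   (tau, z)-plane. *)
definition fourier2_on ::
  "real \<Rightarrow> (real \<times> real) set \<Rightarrow> (real \<Rightarrow> real \<Rightarrow> complex) \<Rightarrow> real \<Rightarrow> real \<Rightarrow> complex" where
  "fourier2_on \<theta> S f t u =
     set_lebesgue_integral lebesgue S
       (\<lambda>(\<tau>, z). f \<tau> z * exp (\<i> * of_real ((z * t - u * \<tau>) * csc \<theta>)))"

(* The Fourier transform on L2 of the plane, in the sense of Plancherel: g is the limit in the
   L2 norm of the Fourier integrals of f over the squares [-R,R] x [-R,R]. The clauses on L2
   membership ensure that every integral below exists. The transform of f is
   determined only up to equality almost everywhere, as always in L2. *)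
definition has_L2_fourier2 ::
  "real \<Rightarrow> (real \<Rightarrow> real \<Rightarrow> complex) \<Rightarrow> (real \<Rightarrow> real \<Rightarrow> complex) \<Rightarrow> bool" where
  "has_L2_fourier2 \<theta> f g \<longleftrightarrow>
     (\<lambda>(\<tau>, z). f \<tau> z) \<in> L2 \<and> (\<lambda>(t, u). g t u) \<in> L2 \<and>
     (\<forall>R. (\<lambda>(t, u). fourier2_on \<theta> ({-R..R} \<times> {-R..R}) f t u) \<in> L2) \<and>
     ((\<lambda>R. LINT (t, u)|lebesgue.
          (norm (fourier2_on \<theta> ({-R..R} \<times> {-R..R}) f t u - g t u))\<^sup>2) \<longlongrightarrow> 0) at_top"

end

theory Submission
  imports Defs "HOL-Probability.Characteristic_Functions"
begin

text \<open>
  Put $c = \csc\theta$ and $G(t, \tau) = x(t + k\tau/2)\,\overline{x(t - k\tau/2)}\,e^{i t k \tau \cot\theta}$. Up to the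
  constant $|\Omega_\theta|^2 = |c| / 2\pi$, the ambiguity function $A(\tau, z)$ is the Fourier transform of $G$ in
  its first variable and the Wigner distribution $W(t, u)$ is the Fourier transform of $G$ in its second
  variable. The two-dimensional integral inverts the first transform, since $|c| / 2\pi$ is exactly the constant
  of the inversion formula, and performs the second one.

  The integral of $A$ over $[-R, R]^2$ is the transform in $\tau$ of a truncated reconstruction $D_R$ of
  $G$. By Plancherel's identity in $\tau$, its $L^2$ distance to $W$ is at most a constant times
  $\|G - D_R\|_2$. By Plancherel's identity in $t$ (lemma \<open>sqnorm_partial_inversion\<close>), the square of that norm
  is bounded, up to constants, by the mass of $G$ over $|\tau| > R$ and that of $A$ over $|z| > R$. Both vanish in the limit, as $G$ and $A$ are
  square-integrable (lemmas \<open>err_bound\<close> and \<open>err_tendsto_0\<close>).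

  If moreover $A$ is integrable, its Fourier integral and $W$ are continuous and agree almost everywhere,
  hence everywhere (lemma \<open>fourier2_A_eq_W\<close>).

  Plancherel's identity on $L^1 \cap L^2$ (lemma \<open>plancherel\<close>) and the continuity of $W$ both rest on the
  continuity of translations in $L^2$ (lemma \<open>sqnorm_translate_tendsto_0\<close>).
\<close>

section \<open>Square-integrable functions on the line\<close>

text \<open>The squared $L^2$ norm on the line, with value $\<infinity>$ when the function is not square-integrable,
  so that Tonelli's theorem and upper bounds need no integrability hypotheses.\<close>

definition sqnorm :: "(real \<Rightarrow> complex) \<Rightarrow> ennreal" where
  "sqnorm f = (\<integral>\<^sup>+t. ennreal ((norm (f t))\<^sup>2) \<partial>lborel)"

lemma norm_add_square_le:
  fixes a b :: "'a::real_normed_vector"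
  shows "(norm (a + b))\<^sup>2 \<le> 2 * (norm a)\<^sup>2 + 2 * (norm b)\<^sup>2"
proof -
  have "(norm (a + b))\<^sup>2 \<le> (norm a + norm b)\<^sup>2"
    by (intro power_mono norm_triangle_ineq) auto
  also have "\<dots> \<le> 2 * (norm a)\<^sup>2 + 2 * (norm b)\<^sup>2"
    using sum_squares_bound[of "norm a" "norm b"] by (simp add: power2_sum)
  finally show ?thesis .
qed

lemma sqnorm_add_le:
  assumes [measurable]: "f \<in> borel_measurable borel" "g \<in> borel_measurable borel"
  shows "sqnorm (\<lambda>t. f t + g t) \<le> 2 * sqnorm f + 2 * sqnorm g"
proof -
  have "sqnorm (\<lambda>t. f t + g t) \<le> (\<integral>\<^sup>+t. 2 * ennreal ((norm (f t))\<^sup>2) + 2 * ennreal ((norm (g t))\<^sup>2) \<partial>lborel)"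
    unfolding sqnorm_def
  proof (intro nn_integral_mono)
    fix t
    have "ennreal ((norm (f t + g t))\<^sup>2) \<le> ennreal (2 * (norm (f t))\<^sup>2 + 2 * (norm (g t))\<^sup>2)"
      by (intro ennreal_leI norm_add_square_le)
    then show "ennreal ((norm (f t + g t))\<^sup>2) \<le> 2 * ennreal ((norm (f t))\<^sup>2) + 2 * ennreal ((norm (g t))\<^sup>2)"
      by (simp add: ennreal_mult'')
  qed
  also have "\<dots> = 2 * sqnorm f + 2 * sqnorm g"
    unfolding sqnorm_def by (simp add: nn_integral_add nn_integral_cmult)
  finally show ?thesis .
qed

lemma sqnorm_minus: "sqnorm (\<lambda>t. - f t) = sqnorm f"
  by (simp add: sqnorm_def)

lemma sqnorm_commute: "sqnorm (\<lambda>t. f t - g t) = sqnorm (\<lambda>t. g t - f t)"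
  by (simp add: sqnorm_def norm_minus_commute)

lemma sqnorm_cnj: "sqnorm (\<lambda>t. cnj (f t)) = sqnorm f"
  by (simp add: sqnorm_def)

lemma sqnorm_cmult:
  assumes [measurable]: "f \<in> borel_measurable borel"
  shows "sqnorm (\<lambda>t. a * f t) = ennreal ((norm a)\<^sup>2) * sqnorm f"
  unfolding sqnorm_def by (simp add: norm_mult power_mult_distrib ennreal_mult' nn_integral_cmult)

lemma sqnorm_affine:
  assumes [measurable]: "f \<in> borel_measurable borel" and "c \<noteq> 0"
  shows "sqnorm (\<lambda>t. f (a + c * t)) = ennreal (1 / \<bar>c\<bar>) * sqnorm f"
proof -
  have "sqnorm f = ennreal \<bar>c\<bar> * sqnorm (\<lambda>t. f (a + c * t))"
    unfolding sqnorm_def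
    by (subst nn_integral_real_affine[where c = c and t = a]) (use assms in auto)
  moreover have "ennreal (1 / \<bar>c\<bar>) * ennreal \<bar>c\<bar> = ennreal (1 / \<bar>c\<bar> * \<bar>c\<bar>)"
    by (subst ennreal_mult) auto
  ultimately have "ennreal (1 / \<bar>c\<bar>) * sqnorm f = ennreal (1 / \<bar>c\<bar> * \<bar>c\<bar>) * sqnorm (\<lambda>t. f (a + c * t))"
    by (metis mult.assoc)
  then show ?thesis using \<open>c \<noteq> 0\<close> by simp
qed

lemma sqnorm_translate:
  assumes [measurable]: "f \<in> borel_measurable borel"
  shows "sqnorm (\<lambda>t. f (t + a)) = sqnorm f"
  using sqnorm_affine[OF assms, of 1 a] by (simp add: add.commute)

lemma numeral_mult_ennreal: "numeral n * ennreal r = ennreal (numeral n * r)"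
  by (cases "0 \<le> r") (simp_all add: ennreal_mult ennreal_neg mult_nonneg_nonpos)

lemma ennreal_tendsto_0I:
  fixes f :: "'a \<Rightarrow> ennreal"
  assumes "\<And>e::real. e > 0 \<Longrightarrow> eventually (\<lambda>x. f x \<le> ennreal e) F"
  shows "(f \<longlongrightarrow> 0) F"
proof (rule order_tendstoI)
  fix a :: ennreal assume "0 < a"
  then obtain e where e: "0 < e" "e < a" using dense by blast
  then have "e < top" using top.not_eq_extremum by fastforce
  then obtain r where r: "e = ennreal r" "r \<ge> 0" by (cases e) auto
  with e have "r > 0" by auto
  from assms[OF this] show "eventually (\<lambda>x. f x < a) F"
    by eventually_elim (use e r in auto)
qed simp

lemma ennreal_tendsto_0D:
  fixes f :: "'a \<Rightarrow> ennreal"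
  assumes "(f \<longlongrightarrow> 0) F" "e > (0::real)"
  shows "eventually (\<lambda>x. f x \<le> ennreal e) F"
proof -
  have "eventually (\<lambda>x. f x < ennreal e) F"
    using assms by (intro order_tendstoD(2)[OF assms(1)]) auto
  then show ?thesis by eventually_elim auto
qed

lemma tendsto_0_mult_left_ennreal:
  fixes f :: "'a \<Rightarrow> ennreal"
  assumes "(f \<longlongrightarrow> 0) F" "c < \<infinity>"
  shows "((\<lambda>x. c * f x) \<longlongrightarrow> 0) F"
  using ennreal_tendsto_cmult[OF _ assms(1), of c] assms(2) by simp

lemma tendsto_0_le_ennreal:
  fixes f g :: "'a \<Rightarrow> ennreal"
  assumes "(g \<longlongrightarrow> 0) F" "\<And>x. f x \<le> g x"
  shows "(f \<longlongrightarrow> 0) F"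
  by (rule tendsto_sandwich[OF _ _ tendsto_const assms(1)]) (use assms in auto)

lemma nn_integral_norm_mult_tendsto_0:
  fixes u :: "nat \<Rightarrow> real \<Rightarrow> complex"
  assumes [measurable]: "\<And>n. u n \<in> borel_measurable borel" "g \<in> borel_measurable borel"
    and u: "(\<lambda>n. sqnorm (u n)) \<longlonglongrightarrow> 0" and g: "sqnorm g < \<infinity>"
  shows "(\<lambda>n. \<integral>\<^sup>+t. ennreal (norm (u n t) * norm (g t)) \<partial>lborel) \<longlonglongrightarrow> 0" (is "?X \<longlonglongrightarrow> 0")
proof -
  have le: "(?X n)\<^sup>2 \<le> sqnorm g * sqnorm (u n)" for n
    using Cauchy_Schwarz_nn_integral[of "\<lambda>t. ennreal (norm (u n t))" lborel "\<lambda>t. ennreal (norm (g t))"]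
    by (simp add: sqnorm_def ennreal_mult' ennreal_power mult.commute)
  have "(\<lambda>n. (?X n)\<^sup>2) \<longlonglongrightarrow> 0"
    by (rule tendsto_0_le_ennreal[OF tendsto_0_mult_left_ennreal[OF u g] le])
  show ?thesis
  proof (rule ennreal_tendsto_0I)
    fix e :: real assume e: "e > 0"
    from ennreal_tendsto_0D[OF \<open>(\<lambda>n. (?X n)\<^sup>2) \<longlonglongrightarrow> 0\<close>, of "e\<^sup>2"] e
    have "eventually (\<lambda>n. (?X n)\<^sup>2 \<le> ennreal (e\<^sup>2)) sequentially" by simp
    then show "eventually (\<lambda>n. ?X n \<le> ennreal e) sequentially"
    proof eventually_elim
      case (elim n)
      then have *: "(?X n)\<^sup>2 \<le> (ennreal e)\<^sup>2" using e by (simp add: ennreal_power)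
      have "?X n \<noteq> top"
      proof
        assume "?X n = top"
        with * show False by (simp add: power2_eq_square top_unique ennreal_mult_eq_top_iff)
      qed
      then obtain r where r: "?X n = ennreal r" "r \<ge> 0" by (cases "?X n") auto
      with * e have "r\<^sup>2 \<le> e\<^sup>2" by (simp add: ennreal_power)
      with e r show ?case by (auto intro!: ennreal_leI power2_le_imp_le)
    qed
  qed
qed

text \<open>The product is continuous from $L^2 \times L^2$ to $L^1$.\<close>

lemma mult_tendsto_L1:
  fixes f' g' :: "nat \<Rightarrow> real \<Rightarrow> complex"
  assumes [measurable]: "\<And>n. f' n \<in> borel_measurable borel" "\<And>n. g' n \<in> borel_measurable borel"
    "f \<in> borel_measurable borel" "g \<in> borel_measurable borel"
    and f: "sqnorm f < \<infinity>" and g: "sqnorm g < \<infinity>"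
    and f': "(\<lambda>n. sqnorm (\<lambda>t. f' n t - f t)) \<longlonglongrightarrow> 0" and g': "(\<lambda>n. sqnorm (\<lambda>t. g' n t - g t)) \<longlonglongrightarrow> 0"
  shows "(\<lambda>n. \<integral>\<^sup>+t. ennreal (norm (f' n t * g' n t - f t * g t)) \<partial>lborel) \<longlonglongrightarrow> 0"
proof -
  let ?F = "\<lambda>n t. f' n t - f t" and ?G = "\<lambda>n t. g' n t - g t"
  have le: "(\<integral>\<^sup>+t. ennreal (norm (f' n t * g' n t - f t * g t)) \<partial>lborel)
      \<le> (sqnorm (?F n) + sqnorm (?G n)) + ((\<integral>\<^sup>+t. ennreal (norm (?F n t) * norm (g t)) \<partial>lborel)
         + (\<integral>\<^sup>+t. ennreal (norm (?G n t) * norm (f t)) \<partial>lborel))" for n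
  proof -
    have "norm (f' n t * g' n t - f t * g t) \<le> ((norm (?F n t))\<^sup>2 + (norm (?G n t))\<^sup>2) +
        (norm (?F n t) * norm (g t) + norm (?G n t) * norm (f t))" for t
    proof -
      have "f' n t * g' n t - f t * g t = ?F n t * ?G n t + (?F n t * g t + ?G n t * f t)"
        by (simp add: algebra_simps)
      then have "norm (f' n t * g' n t - f t * g t)
          \<le> norm (?F n t) * norm (?G n t) + (norm (?F n t) * norm (g t) + norm (?G n t) * norm (f t))"
        by (metis (no_types, lifting) norm_mult norm_triangle_le norm_triangle_ineq add_left_mono)
      moreover have "norm (?F n t) * norm (?G n t) \<le> (norm (?F n t))\<^sup>2 + (norm (?G n t))\<^sup>2"
        using sum_squares_bound[of "norm (?F n t)" "norm (?G n t)", unfolded mult.assoc]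
          mult_nonneg_nonneg[OF norm_ge_zero norm_ge_zero, of "?F n t" "?G n t"] by linarith
      ultimately show ?thesis by linarith
    qed
    then have "(\<integral>\<^sup>+t. ennreal (norm (f' n t * g' n t - f t * g t)) \<partial>lborel)
      \<le> (\<integral>\<^sup>+t. (ennreal ((norm (?F n t))\<^sup>2) + ennreal ((norm (?G n t))\<^sup>2)) +
        (ennreal (norm (?F n t) * norm (g t)) + ennreal (norm (?G n t) * norm (f t))) \<partial>lborel)"
      by (intro nn_integral_mono) (simp flip: ennreal_plus add: ennreal_leI)
    also have "\<dots> = (sqnorm (?F n) + sqnorm (?G n)) + ((\<integral>\<^sup>+t. ennreal (norm (?F n t) * norm (g t)) \<partial>lborel)
         + (\<integral>\<^sup>+t. ennreal (norm (?G n t) * norm (f t)) \<partial>lborel))"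
      unfolding sqnorm_def by (simp add: nn_integral_add)
    finally show ?thesis .
  qed
  have "(\<lambda>n. (sqnorm (?F n) + sqnorm (?G n)) + ((\<integral>\<^sup>+t. ennreal (norm (?F n t) * norm (g t)) \<partial>lborel)
         + (\<integral>\<^sup>+t. ennreal (norm (?G n t) * norm (f t)) \<partial>lborel))) \<longlonglongrightarrow> 0 + 0 + (0 + 0)"
    by (intro tendsto_add nn_integral_norm_mult_tendsto_0 assms) auto
  then show ?thesis by (intro tendsto_0_le_ennreal[OF _ le]) simp
qed

text \<open>Radial projection of the complex plane onto the closed disc of radius $m > 0$ about the origin.\<close>

definition clip :: "real \<Rightarrow> complex \<Rightarrow> complex" where
  "clip m z = of_real (m / max m (norm z)) * z"

lemma norm_clip: "m > 0 \<Longrightarrow> norm (clip m z) \<le> m" "m > 0 \<Longrightarrow> norm (clip m z) \<le> norm z"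
proof -
  assume m: "m > 0"
  then show "norm (clip m z) \<le> m"
    by (simp add: clip_def norm_mult norm_divide field_simps max_def)
  have "m / max m (norm z) \<le> 1" using m by (simp add: field_simps)
  then have "m / max m (norm z) * norm z \<le> 1 * norm z" by (intro mult_right_mono) auto
  then show "norm (clip m z) \<le> norm z"
    using m by (simp add: clip_def norm_mult norm_divide)
qed

lemma clip_eq: "m > 0 \<Longrightarrow> norm z \<le> m \<Longrightarrow> clip m z = z"
  by (simp add: clip_def max_def)

lemma continuous_on_clip: "m > 0 \<Longrightarrow> continuous_on A (clip m)"
  unfolding clip_def by (intro continuous_intros) (auto simp: max_def)

text \<open>A continuous cutoff: $1$ on $[-m, m]$, $0$ outside $[-m-1, m+1]$, and affine in between.\<close>

definition bump :: "real \<Rightarrow> real \<Rightarrow> real" where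
  "bump m t = max 0 (min 1 (m + 1 - \<bar>t\<bar>))"

lemma bump: "0 \<le> bump m t" "bump m t \<le> 1" "\<bar>t\<bar> \<le> m \<Longrightarrow> bump m t = 1" "\<bar>t\<bar> \<ge> m + 1 \<Longrightarrow> bump m t = 0"
  by (auto simp: bump_def)

lemma continuous_on_bump: "continuous_on A (bump m)"
  unfolding bump_def by (intro continuous_intros)

lemma borel_measurable_clip [measurable]: "m > 0 \<Longrightarrow> clip m \<in> borel_measurable borel"
  by (intro borel_measurable_continuous_onI continuous_on_clip)

lemma borel_measurable_bump [measurable]: "bump m \<in> borel_measurable borel"
  by (intro borel_measurable_continuous_onI continuous_on_bump)

lemma norm_sqr_diff_le:
  fixes a b :: "'a::real_normed_vector"
  assumes "norm a \<le> c" "norm b \<le> c"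
  shows "(norm (a - b))\<^sup>2 \<le> 4 * c\<^sup>2"
proof -
  have "norm (a - b) \<le> 2 * c" using assms norm_triangle_ineq4[of a b] by linarith
  then have "(norm (a - b))\<^sup>2 \<le> (2 * c)\<^sup>2" by (intro power_mono) auto
  then show ?thesis by (simp add: power_mult_distrib)
qed

text \<open>Continuous functions of compact support are dense in $L^2$. A measurable function is almost everywhere
  the limit of continuous functions; clipping and cutting these off makes dominated convergence applicable.\<close>

lemma exists_continuous_compact_support_sqnorm_less:
  assumes [measurable]: "f \<in> borel_measurable borel" and fin: "sqnorm f < \<infinity>" and e: "e > (0::real)"
  obtains g m where "continuous_on UNIV g" "\<And>t. \<bar>t\<bar> \<ge> m \<Longrightarrow> g t = 0" "m > 0" "\<And>t. norm (g t) \<le> m"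
    "sqnorm (\<lambda>t. f t - g t) \<le> ennreal e"
proof -
  define F where "F m t = clip (real m + 1) (f t) * of_real (bump (real m + 1) t)" for m t
  have [measurable]: "F m \<in> borel_measurable borel" for m
    unfolding F_def[abs_def]
    by (intro borel_measurable_times borel_measurable_of_real measurable_compose[OF _ borel_measurable_clip]) auto
  have normF: "norm (F m t) \<le> norm (f t)" for m t
  proof -
    have "norm (F m t) \<le> norm (f t) * 1"
      unfolding F_def norm_mult by (intro mult_mono norm_clip) (auto simp: bump)
    then show ?thesis by simp
  qed
  \<comment> \<open>first approximation: \<open>f\<close> by its truncations \<open>F m\<close>\<close>
  have "(\<lambda>m. sqnorm (\<lambda>t. f t - F m t)) \<longlonglongrightarrow> (\<integral>\<^sup>+t. 0 \<partial>(lborel::real measure))"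
    unfolding sqnorm_def
  proof (rule nn_integral_dominated_convergence[where w = "\<lambda>t. 4 * ennreal ((norm (f t))\<^sup>2)"])
    show "AE t in lborel. ennreal ((norm (f t - F j t))\<^sup>2) \<le> 4 * ennreal ((norm (f t))\<^sup>2)" for j
    proof (rule AE_I2)
      fix t :: real
      have "ennreal ((norm (f t - F j t))\<^sup>2) \<le> ennreal (4 * (norm (f t))\<^sup>2)"
        by (intro ennreal_leI norm_sqr_diff_le normF order_refl)
      then show "ennreal ((norm (f t - F j t))\<^sup>2) \<le> 4 * ennreal ((norm (f t))\<^sup>2)"
        by (simp add: ennreal_mult'')
    qed
    show "(\<integral>\<^sup>+t. 4 * ennreal ((norm (f t))\<^sup>2) \<partial>lborel) < \<infinity>"
      using fin by (simp add: nn_integral_cmult sqnorm_def ennreal_mult_less_top)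
    show "AE t in lborel. (\<lambda>m. ennreal ((norm (f t - F m t))\<^sup>2)) \<longlonglongrightarrow> 0"
    proof (rule AE_I2)
      fix t :: real
      obtain N where N: "real N \<ge> max (norm (f t)) \<bar>t\<bar>" using real_arch_simple by blast
      have "F m t = f t" if "m \<ge> N" for m
      proof -
        have "real m \<ge> real N" using that by simp
        then show ?thesis using N by (simp add: F_def clip_eq bump)
      qed
      then have "eventually (\<lambda>m. ennreal ((norm (f t - F m t))\<^sup>2) = 0) sequentially"
        by (intro eventually_sequentiallyI[of N]) simp
      then show "(\<lambda>m. ennreal ((norm (f t - F m t))\<^sup>2)) \<longlonglongrightarrow> 0" by (rule tendsto_eventually)
    qed
  qed auto
  then have "(\<lambda>m. sqnorm (\<lambda>t. f t - F m t)) \<longlonglongrightarrow> 0" by simp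
  from ennreal_tendsto_0D[OF this, of "e / 4"] e
  obtain M where M: "sqnorm (\<lambda>t. f t - F M t) \<le> ennreal (e / 4)"
    by (auto simp: eventually_sequentially)
  have "f \<in> borel_measurable lebesgue" by (simp add: measurable_completion)
  then have "f measurable_on UNIV"
    using lebesgue_measurable_imp_measurable_on[of f UNIV] by simp
  then obtain N g where N: "negligible N" and g: "\<And>n. continuous_on UNIV (g n)"
    and lim: "\<And>t. t \<notin> N \<Longrightarrow> (\<lambda>n. g n t) \<longlonglongrightarrow> f t"
    unfolding measurable_on_def by auto
  define h where "h n t = clip (real M + 1) (g n t) * of_real (bump (real M + 1) t)" for n t
  have conth: "continuous_on UNIV (h n)" for n
    unfolding h_def by (intro continuous_intros continuous_on_bump continuous_on_compose2[OF continuous_on_clip g]) auto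
  have [measurable]: "h n \<in> borel_measurable borel" for n
    by (intro borel_measurable_continuous_onI conth)
  have normh: "norm (h n t) \<le> (real M + 1) * indicator {-(real M + 2)..real M + 2} t"
      "norm (F M t) \<le> (real M + 1) * indicator {-(real M + 2)..real M + 2} t" for n t
  proof -
    have "bump (real M + 1) t \<le> indicator {-(real M + 2)..real M + 2} t"
      by (auto simp: bump indicator_def)
    then show "norm (h n t) \<le> (real M + 1) * indicator {-(real M + 2)..real M + 2} t"
      "norm (F M t) \<le> (real M + 1) * indicator {-(real M + 2)..real M + 2} t"
      unfolding h_def F_def norm_mult by (auto intro!: mult_mono norm_clip simp: bump)
  qed
  \<comment> \<open>second approximation: \<open>F M\<close>, which is bounded with bounded support, by the continuous \<open>h n\<close>\<close>
  have "(\<lambda>n. sqnorm (\<lambda>t. F M t - h n t)) \<longlonglongrightarrow> (\<integral>\<^sup>+t. 0 \<partial>(lborel::real measure))"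
    unfolding sqnorm_def
  proof (rule nn_integral_dominated_convergence[where w = "\<lambda>t. ennreal (4 * (real M + 1)\<^sup>2) * indicator {-(real M + 2)..real M + 2} t"])
    show "AE t in lborel. ennreal ((norm (F M t - h j t))\<^sup>2) \<le> ennreal (4 * (real M + 1)\<^sup>2) * indicator {-(real M + 2)..real M + 2} t" for j
    proof (rule AE_I2)
      fix t :: real
      have "ennreal ((norm (F M t - h j t))\<^sup>2) \<le> ennreal (4 * ((real M + 1) * indicator {-(real M + 2)..real M + 2} t)\<^sup>2)"
        by (intro ennreal_leI norm_sqr_diff_le normh)
      then show "ennreal ((norm (F M t - h j t))\<^sup>2) \<le> ennreal (4 * (real M + 1)\<^sup>2) * indicator {-(real M + 2)..real M + 2} t"
        by (auto simp: indicator_def)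
    qed
    show "(\<integral>\<^sup>+t. ennreal (4 * (real M + 1)\<^sup>2) * indicator {-(real M + 2)..real M + 2} t \<partial>lborel) < \<infinity>"
      by (simp add: nn_integral_cmult_indicator ennreal_mult_less_top)
    \<comment> \<open>almost everywhere, \<open>h n\<close> tends to \<open>F M\<close>, since \<open>clip\<close> is continuous\<close>
  have "N \<in> null_sets lebesgue" using N by (simp add: negligible_iff_null_sets)
    then have "AE t in lebesgue. t \<notin> N" by (rule AE_not_in)
    then have "AE t in lborel. t \<notin> N" by (simp add: AE_completion_iff)
    then show "AE t in lborel. (\<lambda>n. ennreal ((norm (F M t - h n t))\<^sup>2)) \<longlonglongrightarrow> 0"
    proof eventually_elim
      case (elim t)
      have "isCont (clip (real M + 1)) (f t)"
        using continuous_on_clip[of "real M + 1" UNIV] by (simp add: continuous_on_eq_continuous_at)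
      from isCont_tendsto_compose[OF this lim[OF elim]]
      have "(\<lambda>n. h n t) \<longlonglongrightarrow> F M t"
        unfolding h_def F_def by (intro tendsto_mult tendsto_const)
      then have "(\<lambda>n. ennreal ((norm (F M t - h n t))\<^sup>2)) \<longlonglongrightarrow> ennreal ((norm (F M t - F M t))\<^sup>2)"
        by (intro tendsto_intros)
      then show ?case by simp
    qed
  qed auto
  then have "(\<lambda>n. sqnorm (\<lambda>t. F M t - h n t)) \<longlonglongrightarrow> 0" by simp
  from ennreal_tendsto_0D[OF this, of "e / 4"] e
  obtain n where n: "sqnorm (\<lambda>t. F M t - h n t) \<le> ennreal (e / 4)"
    by (auto simp: eventually_sequentially)
  show thesis
  proof (rule that[of "h n" "real M + 2"])
    show "h n t = 0" if "\<bar>t\<bar> \<ge> real M + 2" for t using that by (simp add: h_def bump)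
    show "norm (h n t) \<le> real M + 2" for t
    proof -
      have "norm (h n t) \<le> (real M + 1) * 1"
        unfolding h_def norm_mult by (intro mult_mono norm_clip) (auto simp: bump)
      then show ?thesis by simp
    qed
    have "sqnorm (\<lambda>t. f t - h n t) = sqnorm (\<lambda>t. (f t - F M t) + (F M t - h n t))" by simp
    also have "\<dots> \<le> 2 * sqnorm (\<lambda>t. f t - F M t) + 2 * sqnorm (\<lambda>t. F M t - h n t)"
      by (intro sqnorm_add_le) auto
    also have "\<dots> \<le> 2 * ennreal (e / 4) + 2 * ennreal (e / 4)"
      using M n by (intro add_mono mult_left_mono) auto
    also have "\<dots> = ennreal (2 * (e / 4) + 2 * (e / 4))"
      using e by (simp only: numeral_mult_ennreal ennreal_plus[symmetric] mult_nonneg_nonneg add_nonneg_nonneg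
          divide_nonneg_nonneg zero_le_numeral less_imp_le)
    finally show "sqnorm (\<lambda>t. f t - h n t) \<le> ennreal e" by simp
  qed (use conth in auto)
qed

text \<open>Translation is continuous in $L^2$.\<close>

lemma sqnorm_translate_tendsto_0:
  fixes v :: "nat \<Rightarrow> real"
  assumes [measurable]: "f \<in> borel_measurable borel" and fin: "sqnorm f < \<infinity>" and v: "v \<longlonglongrightarrow> 0"
  shows "(\<lambda>n. sqnorm (\<lambda>t. f (t + v n) - f t)) \<longlonglongrightarrow> 0"
proof (rule ennreal_tendsto_0I)
  fix e :: real assume e: "e > 0"
  obtain g m where g: "continuous_on UNIV g" "\<And>t. \<bar>t\<bar> \<ge> m \<Longrightarrow> g t = 0" "m > 0" "\<And>t. norm (g t) \<le> m"
    "sqnorm (\<lambda>t. f t - g t) \<le> ennreal (e / 12)"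
    using exists_continuous_compact_support_sqnorm_less[OF assms(1) fin, of "e / 12"] e by auto
  have [measurable]: "g \<in> borel_measurable borel" by (intro borel_measurable_continuous_onI g)
  obtain B where "\<And>n. \<bar>v n\<bar> \<le> B"
    using convergent_imp_Bseq[OF convergentI[OF v]] by (auto simp: Bseq_def)
  then have B: "- v n \<le> B" "v n \<le> B" for n by (auto simp: abs_le_iff dest: spec[of _ n])
  have "(\<lambda>n. sqnorm (\<lambda>t. g (t + v n) - g t)) \<longlonglongrightarrow> (\<integral>\<^sup>+t. 0 \<partial>(lborel::real measure))"
    unfolding sqnorm_def
  proof (rule nn_integral_dominated_convergence[where w = "\<lambda>t. ennreal (4 * m\<^sup>2) * indicator {-(m+B)..m+B} t"])
    show "AE t in lborel. ennreal ((norm (g (t + v j) - g t))\<^sup>2) \<le> ennreal (4 * m\<^sup>2) * indicator {-(m+B)..m+B} t" for j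
    proof (rule AE_I2)
      fix t :: real
      have "ennreal ((norm (g (t + v j) - g t))\<^sup>2) \<le> ennreal (4 * m\<^sup>2)"
        by (intro ennreal_leI norm_sqr_diff_le g)
      moreover have "g (t + v j) - g t = 0" if "t \<notin> {-(m+B)..m+B}"
      proof -
        have "\<bar>t\<bar> \<ge> m" "\<bar>t + v j\<bar> \<ge> m" using that B[of j] by auto
        then show ?thesis by (simp add: g)
      qed
      ultimately show "ennreal ((norm (g (t + v j) - g t))\<^sup>2) \<le> ennreal (4 * m\<^sup>2) * indicator {-(m+B)..m+B} t"
        by (auto simp: indicator_def)
    qed
    have "{-(m+B)..m+B} \<in> sets lborel" "emeasure lborel {-(m+B)..m+B} < \<infinity>" by (auto simp: emeasure_lborel_Icc_eq)
    then show "(\<integral>\<^sup>+t. ennreal (4 * m\<^sup>2) * indicator {-(m+B)..m+B} t \<partial>lborel) < \<infinity>"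
      by (simp add: nn_integral_cmult_indicator ennreal_mult_less_top)
    show "AE t in lborel. (\<lambda>n. ennreal ((norm (g (t + v n) - g t))\<^sup>2)) \<longlonglongrightarrow> 0"
    proof (rule AE_I2)
      fix t :: real
      have "isCont g t" using g(1) by (simp add: continuous_on_eq_continuous_at)
      moreover have "(\<lambda>n. t + v n) \<longlonglongrightarrow> t" using tendsto_add[OF tendsto_const v, of t] by simp
      ultimately have "(\<lambda>n. g (t + v n)) \<longlonglongrightarrow> g t" by (rule isCont_tendsto_compose)
      then have "(\<lambda>n. ennreal ((norm (g (t + v n) - g t))\<^sup>2)) \<longlonglongrightarrow> ennreal ((norm (g t - g t))\<^sup>2)"
        by (intro tendsto_intros)
      then show "(\<lambda>n. ennreal ((norm (g (t + v n) - g t))\<^sup>2)) \<longlonglongrightarrow> 0" by simp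
    qed
  qed auto
  then have "(\<lambda>n. sqnorm (\<lambda>t. g (t + v n) - g t)) \<longlonglongrightarrow> 0" by simp
  from ennreal_tendsto_0D[OF this, of "e / 12"] e
  have "eventually (\<lambda>n. sqnorm (\<lambda>t. g (t + v n) - g t) \<le> ennreal (e / 12)) sequentially" by simp
  then show "eventually (\<lambda>n. sqnorm (\<lambda>t. f (t + v n) - f t) \<le> ennreal e) sequentially"
  proof eventually_elim
    case (elim n)
    have "sqnorm (\<lambda>t. f (t + v n) - f t) =
        sqnorm (\<lambda>t. (f (t + v n) - g (t + v n)) + ((g (t + v n) - g t) + (g t - f t)))" by simp
    also have "\<dots> \<le> 2 * sqnorm (\<lambda>t. f (t + v n) - g (t + v n)) + 2 * sqnorm (\<lambda>t. (g (t + v n) - g t) + (g t - f t))"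
      by (intro sqnorm_add_le) auto
    also have "\<dots> \<le> 2 * sqnorm (\<lambda>t. f (t + v n) - g (t + v n)) +
        2 * (2 * sqnorm (\<lambda>t. g (t + v n) - g t) + 2 * sqnorm (\<lambda>t. g t - f t))"
      by (intro add_mono mult_left_mono sqnorm_add_le order_refl) auto
    also have "\<dots> \<le> 2 * ennreal (e / 12) + 2 * (2 * ennreal (e / 12) + 2 * ennreal (e / 12))"
      using elim g(5) sqnorm_translate[of "\<lambda>t. f t - g t" "v n"] sqnorm_commute[of f g]
      by (intro add_mono mult_left_mono) auto
    also have "\<dots> = ennreal (2 * (e / 12) + 2 * (2 * (e / 12) + 2 * (e / 12)))"
      using e by (simp only: numeral_mult_ennreal ennreal_plus[symmetric] mult_nonneg_nonneg add_nonneg_nonneg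
          divide_nonneg_nonneg zero_le_numeral less_imp_le)
    also have "\<dots> \<le> ennreal e" using e by (intro ennreal_leI) auto
    finally show ?case .
  qed
qed

lemma sqnorm_finite:
  assumes [measurable]: "f \<in> borel_measurable borel" and fin: "sqnorm f < \<infinity>"
  shows "integrable lborel (\<lambda>t. (norm (f t))\<^sup>2)"
    and "sqnorm f = ennreal (LINT t|lborel. (norm (f t))\<^sup>2)"
proof -
  show *: "integrable lborel (\<lambda>t. (norm (f t))\<^sup>2)"
    using fin unfolding sqnorm_def integrable_iff_bounded by simp
  show "sqnorm f = ennreal (LINT t|lborel. (norm (f t))\<^sup>2)"
    unfolding sqnorm_def by (rule nn_integral_eq_integral[OF *]) auto
qed

lemma norm_mult_le_squares:
  fixes a b :: "'a::real_normed_algebra"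
  shows "norm (a * b) \<le> ((norm a)\<^sup>2 + (norm b)\<^sup>2) / 2"
  using norm_mult_ineq[of a b] sum_squares_bound[of "norm a" "norm b", unfolded mult.assoc] by simp

lemma integrable_mult_sqnorm:
  assumes [measurable]: "f \<in> borel_measurable borel" "g \<in> borel_measurable borel"
    and "sqnorm f < \<infinity>" "sqnorm g < \<infinity>"
  shows "integrable lborel (\<lambda>t. f t * g t)"
proof (rule Bochner_Integration.integrable_bound)
  show "integrable lborel (\<lambda>t. ((norm (f t))\<^sup>2 + (norm (g t))\<^sup>2) / 2)"
    using assms by (intro integrable_divide_zero Bochner_Integration.integrable_add sqnorm_finite)
  show "AE t in lborel. norm (f t * g t) \<le> norm (((norm (f t))\<^sup>2 + (norm (g t))\<^sup>2) / 2)"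
    using norm_mult_le_squares[of "f _" "g _"] by simp
qed measurable

section \<open>Fourier integrals and Plancherel's identity\<close>

text \<open>The Fourier integral with frequency scale $c$. One definition with both signs of $c$ serves for the
  transform and for its inverse: up to the factor $|c| / 2\pi$, \<^term>\<open>fourier c\<close> inverts
  \<^term>\<open>fourier (- c)\<close>.\<close>

definition fourier :: "real \<Rightarrow> (real \<Rightarrow> complex) \<Rightarrow> real \<Rightarrow> complex" where
  "fourier c f \<xi> = (LINT t|lborel. f t * exp (\<i> * of_real (c * t * \<xi>)))"

lemma borel_measurable_cnj [measurable]: "cnj \<in> borel_measurable borel"
  by (intro borel_measurable_continuous_onI continuous_intros)

lemma integrable_mult_exp:
  fixes f :: "'a \<Rightarrow> complex"
  assumes f: "integrable M f" and [measurable]: "g \<in> borel_measurable M"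
  shows "integrable M (\<lambda>t. f t * exp (\<i> * of_real (g t)))"
proof -
  have [measurable]: "f \<in> borel_measurable M" using f by auto
  show ?thesis
    by (rule Bochner_Integration.integrable_bound[OF f]) (auto simp: norm_mult)
qed

lemma borel_measurable_fourier_parametric [measurable (raw)]:
  assumes [measurable]: "case_prod f \<in> borel_measurable (M \<Otimes>\<^sub>M borel)" "g \<in> borel_measurable M"
  shows "(\<lambda>x. fourier c (f x) (g x)) \<in> borel_measurable M"
proof -
  have [measurable]: "case_prod f \<in> borel_measurable (M \<Otimes>\<^sub>M lborel)"
    by measurable
  show ?thesis unfolding fourier_def by measurable
qed

lemma borel_measurable_fourier [measurable]:
  assumes [measurable]: "f \<in> borel_measurable borel"
  shows "fourier c f \<in> borel_measurable borel"
  unfolding fourier_def[abs_def] by measurable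

lemma norm_fourier_le: 
  assumes "integrable lborel f"
  shows "norm (fourier c f \<xi>) \<le> (LINT t|lborel. norm (f t))"
  unfolding fourier_def
  using integral_norm_bound[of lborel "\<lambda>t. f t * exp (\<i> * of_real (c * t * \<xi>))"]
  by (simp add: norm_mult)

lemma fourier_scale: "fourier c f \<xi> = fourier 1 f (c * \<xi>)"
  by (simp add: fourier_def mult_ac)

lemma cnj_fourier: "cnj (fourier c f \<xi>) = fourier (- c) (\<lambda>t. cnj (f t)) \<xi>"
proof -
  have "cnj (fourier c f \<xi>) = (LINT t|lborel. cnj (f t * exp (\<i> * of_real (c * t * \<xi>))))"
    unfolding fourier_def by (rule Bochner_Integration.integral_cnj[symmetric])
  also have "\<dots> = fourier (- c) (\<lambda>t. cnj (f t)) \<xi>"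
    unfolding fourier_def by (rule Bochner_Integration.integral_cong) (simp_all add: exp_cnj)
  finally show ?thesis .
qed

lemma fourier_diff:
  assumes "integrable lborel f" "integrable lborel g"
  shows "fourier c (\<lambda>t. f t - g t) \<xi> = fourier c f \<xi> - fourier c g \<xi>"
  unfolding fourier_def left_diff_distrib
  by (intro Bochner_Integration.integral_diff integrable_mult_exp assms) measurable

lemma fourier_multiplication_formula:
  assumes f: "integrable lborel f" and g: "integrable lborel g"
  shows "(LINT \<xi>|lborel. fourier c f \<xi> * g \<xi>) = (LINT t|lborel. f t * fourier c g t)"
proof -
  let ?h = "\<lambda>t \<xi>. f t * g \<xi> * exp (\<i> * of_real (c * t * \<xi>))"
  have [measurable]: "f \<in> borel_measurable borel" "g \<in> borel_measurable borel"
    using f g by (auto dest: borel_measurable_integrable)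
  have "integrable (lborel \<Otimes>\<^sub>M lborel) (case_prod ?h)"
  proof (rule lborel_pair.Fubini_integrable)
    show "integrable lborel (\<lambda>t. LINT \<xi>|lborel. norm (case_prod ?h (t, \<xi>)))"
      using f g by (simp add: norm_mult)
    show "AE t in lborel. integrable lborel (\<lambda>\<xi>. case_prod ?h (t, \<xi>))"
      using integrable_mult_exp[OF integrable_mult_right[OF g], of "\<lambda>\<xi>. c * _ * \<xi>"] by simp
  qed measurable
  from lborel_pair.Fubini_integral[OF this]
  have "(LINT \<xi>|lborel. LINT t|lborel. ?h t \<xi>) = (LINT t|lborel. LINT \<xi>|lborel. ?h t \<xi>)" .
  moreover have "(LINT t|lborel. ?h t \<xi>) = fourier c f \<xi> * g \<xi>" for \<xi>
  proof -
    have "(LINT t|lborel. ?h t \<xi>) = (LINT t|lborel. (f t * exp (\<i> * of_real (c * t * \<xi>))) * g \<xi>)"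
      by (simp add: mult_ac)
    then show ?thesis by (simp add: fourier_def)
  qed
  moreover have "(LINT \<xi>|lborel. ?h t \<xi>) = f t * fourier c g t" for t
  proof -
    have "(LINT \<xi>|lborel. ?h t \<xi>) = (LINT \<xi>|lborel. f t * (g \<xi> * exp (\<i> * of_real (c * \<xi> * t))))"
      by (simp add: mult_ac)
    then show ?thesis by (simp add: fourier_def)
  qed
  ultimately show ?thesis by simp
qed

text \<open>The autocorrelation $r(v) = \int f(t + v) \overline{f(t)}\,dt$, whose Fourier transform is
  $|\hat f|^2$ and whose value at $0$ is $\|f\|_2^2$.\<close>

definition autocorr :: "(real \<Rightarrow> complex) \<Rightarrow> real \<Rightarrow> complex" where
  "autocorr f v = (LINT t|lborel. f (t + v) * cnj (f t))"

lemma borel_measurable_autocorr [measurable]: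
  assumes [measurable]: "f \<in> borel_measurable borel"
  shows "autocorr f \<in> borel_measurable borel"
  unfolding autocorr_def[abs_def] by measurable

lemma
  assumes f: "integrable lborel f"
  shows integrable_autocorr: "integrable lborel (autocorr f)"
    and fourier_autocorr: "fourier 1 (autocorr f) \<xi> = of_real ((norm (fourier 1 f \<xi>))\<^sup>2)"
proof -
  have [measurable]: "f \<in> borel_measurable borel"
    using f by (auto dest: borel_measurable_integrable)
  have shift: "integrable lborel (\<lambda>v. f (t + v))" for t
    using lborel_integrable_real_affine[OF f, of 1 t] by simp
  have shiftn: "(LINT v|lborel. norm (f (t + v))) = (LINT v|lborel. norm (f v))" for t
    using lborel_integral_real_affine[of 1 "\<lambda>v. norm (f v)" t] by simp
  have int: "integrable (lborel \<Otimes>\<^sub>M lborel) (\<lambda>(t, v). f (t + v) * cnj (f t))"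
  proof (rule lborel_pair.Fubini_integrable)
    show "integrable lborel (\<lambda>t. LINT v|lborel. norm (case (t, v) of (t, v) \<Rightarrow> f (t + v) * cnj (f t)))"
      using f by (simp add: norm_mult shiftn)
    show "AE t in lborel. integrable lborel (\<lambda>v. case (t, v) of (t, v) \<Rightarrow> f (t + v) * cnj (f t))"
      using shift by simp
  qed measurable
  from lborel_pair.integrable_snd[OF int] show "integrable lborel (autocorr f)"
    by (simp add: autocorr_def[abs_def])
  let ?h = "\<lambda>t v. (f (t + v) * cnj (f t)) * exp (\<i> * of_real (v * \<xi>))"
  have "integrable (lborel \<Otimes>\<^sub>M lborel) (\<lambda>z. (case z of (t, v) \<Rightarrow> f (t + v) * cnj (f t)) * exp (\<i> * of_real (snd z * \<xi>)))"
    by (intro integrable_mult_exp int) measurable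
  then have "integrable (lborel \<Otimes>\<^sub>M lborel) (case_prod ?h)"
    by (simp only: case_prod_unfold)
  from lborel_pair.Fubini_integral[OF this]
  have 1: "(LINT v|lborel. LINT t|lborel. ?h t v) = (LINT t|lborel. LINT v|lborel. ?h t v)" .
  have 2: "(LINT v|lborel. LINT t|lborel. ?h t v) = fourier 1 (autocorr f) \<xi>"
    by (simp add: fourier_def autocorr_def)
  have 3: "(LINT v|lborel. ?h t v) = fourier 1 f \<xi> * cnj (f t * exp (\<i> * of_real (t * \<xi>)))" for t
  proof -
    have "fourier 1 f \<xi> = (LINT v|lborel. f (t + v) * exp (\<i> * of_real ((t + v) * \<xi>)))"
      unfolding fourier_def using lborel_integral_real_affine[of 1 "\<lambda>v. f v * exp (\<i> * of_real (v * \<xi>))" t] by simp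
    moreover have "?h t v = (f (t + v) * exp (\<i> * of_real ((t + v) * \<xi>))) * cnj (f t * exp (\<i> * of_real (t * \<xi>)))" for v
    proof -
      have "exp (\<i> * of_real (v * \<xi>)) = exp (\<i> * of_real ((t + v) * \<xi>)) * cnj (exp (\<i> * of_real (t * \<xi>)))"
        by (simp add: exp_cnj flip: exp_add) (simp add: algebra_simps)
      then show ?thesis by simp
    qed
    ultimately show ?thesis by (simp only: integral_mult_left_zero)
  qed
  have 4: "(LINT t|lborel. fourier 1 f \<xi> * cnj (f t * exp (\<i> * of_real (t * \<xi>))))
     = fourier 1 f \<xi> * cnj (fourier 1 f \<xi>)"
    by (simp only: integral_mult_right_zero Bochner_Integration.integral_cnj fourier_def mult_1)
  show "fourier 1 (autocorr f) \<xi> = of_real ((norm (fourier 1 f \<xi>))\<^sup>2)"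
    unfolding complex_norm_square 2[symmetric] 1 3 4 ..
qed

lemma autocorr_bound:
  assumes [measurable]: "f \<in> borel_measurable borel" and fin: "sqnorm f < \<infinity>"
  shows "norm (autocorr f v) \<le> (LINT t|lborel. (norm (f t))\<^sup>2)"
proof -
  note sq = sqnorm_finite[OF assms]
  have sq': "integrable lborel (\<lambda>t. (norm (f (t + v)))\<^sup>2)"
    "(LINT t|lborel. (norm (f (t + v)))\<^sup>2) = (LINT t|lborel. (norm (f t))\<^sup>2)"
    using lborel_integrable_real_affine[OF sq(1), of 1 v]
      lborel_integral_real_affine[of 1 "\<lambda>t. (norm (f t))\<^sup>2" v] by (simp_all add: add.commute)
  have "norm (autocorr f v) \<le> (LINT t|lborel. norm (f (t + v) * cnj (f t)))"
    unfolding autocorr_def by (rule integral_norm_bound)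
  also have "\<dots> \<le> (LINT t|lborel. ((norm (f (t + v)))\<^sup>2 + (norm (f t))\<^sup>2) / 2)"
  proof (rule integral_mono')
    show "norm (f (t + v) * cnj (f t)) \<le> ((norm (f (t + v)))\<^sup>2 + (norm (f t))\<^sup>2) / 2" for t
      using norm_mult_le_squares[of "f (t + v)" "cnj (f t)"] by simp
  qed (use sq(1) sq' in auto)
  also have "\<dots> = (LINT t|lborel. (norm (f t))\<^sup>2)"
    using sq(1) sq' by simp
  finally show ?thesis .
qed

lemma autocorr_0: "autocorr f 0 = of_real (LINT t|lborel. (norm (f t))\<^sup>2)"
  unfolding autocorr_def integral_complex_of_real[symmetric]
  by (rule Bochner_Integration.integral_cong) (simp_all only: complex_norm_square add_0_right)

lemma tendsto_autocorr:
  fixes v :: "nat \<Rightarrow> real"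
  assumes [measurable]: "f \<in> borel_measurable borel" and fin: "sqnorm f < \<infinity>" and v: "v \<longlonglongrightarrow> 0"
  shows "(\<lambda>n. autocorr f (v n)) \<longlonglongrightarrow> autocorr f 0"
  unfolding autocorr_def
proof (rule tendsto_L1_int)
  show "(\<lambda>n. \<integral>\<^sup>+t. ennreal (norm (f (t + v n) * cnj (f t) - f (t + 0) * cnj (f t))) \<partial>lborel) \<longlonglongrightarrow> 0"
    using mult_tendsto_L1[of "\<lambda>n t. f (t + v n)" "\<lambda>n t. cnj (f t)" f "\<lambda>t. cnj (f t)"]
      sqnorm_translate_tendsto_0[OF assms] fin
    by (simp add: sqnorm_cnj sqnorm_def)
qed (intro integrable_mult_sqnorm; use fin in \<open>simp add: sqnorm_translate sqnorm_cnj\<close>)+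

lemma fourier_gaussian:
  assumes n: "n > 0"
  shows "integrable lborel (\<lambda>\<xi>. complex_of_real (exp (- (\<xi> / n)\<^sup>2 / 2)))"
    and "fourier 1 (\<lambda>\<xi>. of_real (exp (- (\<xi> / n)\<^sup>2 / 2))) v = of_real (n * sqrt (2 * pi) * exp (- (n * v)\<^sup>2 / 2))"
proof -
  have dens: "std_normal_density x = exp (- x\<^sup>2 / 2) / sqrt (2 * pi)" for x
    by (simp add: normal_density_def)
  have "integrable lborel std_normal_density" by (rule integrable_normal_density) simp
  then have "integrable lborel (\<lambda>x. sqrt (2 * pi) * std_normal_density x)" by simp
  then have e: "integrable lborel (\<lambda>x::real. exp (- x\<^sup>2 / 2))" by (simp add: dens)
  from lborel_integrable_real_affine[OF e, of "1 / n" 0] n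
  show "integrable lborel (\<lambda>\<xi>. complex_of_real (exp (- (\<xi> / n)\<^sup>2 / 2)))" by simp
  have 1: "fourier 1 (\<lambda>x. of_real (exp (- x\<^sup>2 / 2))) w = of_real (sqrt (2 * pi) * exp (- w\<^sup>2 / 2))" for w
  proof -
    have "of_real (exp (- w\<^sup>2 / 2)) = char std_normal_distribution w"
      by (simp add: char_std_normal_distribution)
    also have "\<dots> = (LINT x|lborel. std_normal_density x *\<^sub>R exp (\<i> * of_real (w * x)))"
      unfolding char_def by (subst integral_density) auto
    also have "\<dots> = (LINT x|lborel. of_real (exp (- x\<^sup>2 / 2)) * exp (\<i> * of_real (1 * x * w)) / of_real (sqrt (2 * pi)))"
      by (simp only: dens scaleR_conv_of_real of_real_divide mult_1 mult.commute[of _ w] times_divide_eq_left)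
    also have "\<dots> = fourier 1 (\<lambda>x. of_real (exp (- x\<^sup>2 / 2))) w / of_real (sqrt (2 * pi))"
      unfolding fourier_def by simp
    finally show ?thesis by (simp add: field_simps)
  qed
  have "fourier 1 (\<lambda>\<xi>. of_real (exp (- (\<xi> / n)\<^sup>2 / 2))) v
      = of_real n * (LINT x|lborel. of_real (exp (- (n * x / n)\<^sup>2 / 2)) * exp (\<i> * of_real (1 * (n * x) * v)))"
    unfolding fourier_def using n
    by (subst lborel_integral_real_affine[where c = n and t = 0]) (auto simp: scaleR_conv_of_real)
  also have "(LINT x|lborel. of_real (exp (- (n * x / n)\<^sup>2 / 2)) * exp (\<i> * of_real (1 * (n * x) * v))) =
     fourier 1 (\<lambda>x. of_real (exp (- x\<^sup>2 / 2))) (n * v)"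
    using n by (simp add: fourier_def mult_ac)
  finally show "fourier 1 (\<lambda>\<xi>. of_real (exp (- (\<xi> / n)\<^sup>2 / 2))) v = of_real (n * sqrt (2 * pi) * exp (- (n * v)\<^sup>2 / 2))"
    by (simp only: 1 of_real_mult mult.assoc)
qed

text \<open>Plancherel's identity for $f \in L^1 \cap L^2$, by Gaussian summation. The multiplication formula
  applied to the autocorrelation $r$ and a Gaussian of width $n$ gives
  $\int |\hat f(\xi)|^2 e^{-(\xi/n)^2/2}\,d\xi = \sqrt{2\pi} \int r(y/n) e^{-y^2/2}\,dy$.
  As $n$ grows, the left side increases to $\|\hat f\|_2^2$, and the right side tends to
  $2\pi\, r(0) = 2\pi \|f\|_2^2$, because $r$ is bounded and continuous at $0$.\<close>

lemma plancherel_1: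
  assumes f: "integrable lborel f" and fin: "sqnorm f < \<infinity>"
  shows "sqnorm (fourier 1 f) = ennreal (2 * pi) * sqnorm f"
proof -
  have [measurable]: "f \<in> borel_measurable borel"
    using f by (auto dest: borel_measurable_integrable)
  define W where "W n \<xi> = exp (- (\<xi> / real (Suc n))\<^sup>2 / 2)" for n \<xi>
  let ?E = "\<lambda>y::real. exp (- y\<^sup>2 / 2)"
  define N where "N = (LINT t|lborel. (norm (f t))\<^sup>2)"
  define B where "B = (LINT t|lborel. norm (f t))"
  have normf: "norm (fourier 1 f \<xi>) \<le> B" for \<xi> unfolding B_def by (rule norm_fourier_le[OF f])
  have [measurable]: "W n \<in> borel_measurable borel" for n unfolding W_def[abs_def] by measurable
  have Wint: "integrable lborel (\<lambda>\<xi>. complex_of_real (W n \<xi>))" for n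
    unfolding W_def by (rule fourier_gaussian(1)) simp
  have Ei: "integrable lborel ?E"
    using fourier_gaussian(1)[of 1] by (simp only: complex_of_real_integrable_eq div_by_1 zero_less_one simp_thms)
  have Eint: "(LINT y|lborel. ?E y) = sqrt (2 * pi)"
  proof -
    have "complex_of_real (LINT y|lborel. ?E y) = of_real (sqrt (2 * pi))"
      using fourier_gaussian(2)[of 1 0] by (simp add: fourier_def flip: integral_complex_of_real)
    then show ?thesis by (simp only: of_real_eq_iff)
  qed
  have eq: "(LINT \<xi>|lborel. of_real ((norm (fourier 1 f \<xi>))\<^sup>2) * of_real (W n \<xi>))
     = (LINT y|lborel. autocorr f (y / real (Suc n)) * of_real (sqrt (2 * pi) * ?E y))" for n
  proof -
    let ?n = "real (Suc n)"
    have "(LINT \<xi>|lborel. of_real ((norm (fourier 1 f \<xi>))\<^sup>2) * of_real (W n \<xi>))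
      = (LINT \<xi>|lborel. fourier 1 (autocorr f) \<xi> * of_real (W n \<xi>))"
      by (simp add: fourier_autocorr[OF f])
    also have "\<dots> = (LINT v|lborel. autocorr f v * fourier 1 (\<lambda>\<xi>. of_real (W n \<xi>)) v)"
      by (rule fourier_multiplication_formula[OF integrable_autocorr[OF f] Wint])
    also have "\<dots> = (LINT v|lborel. autocorr f v * of_real (?n * sqrt (2 * pi) * exp (- (?n * v)\<^sup>2 / 2)))"
      unfolding W_def by (subst fourier_gaussian(2)) auto
    also have "\<dots> = of_real (1 / ?n) * (LINT y|lborel. autocorr f (y / ?n) * of_real (?n * sqrt (2 * pi) * exp (- (?n * (y / ?n))\<^sup>2 / 2)))"
      by (subst lborel_integral_real_affine[where c = "1 / ?n" and t = 0]) (auto simp: scaleR_conv_of_real)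
    also have "\<dots> = (LINT y|lborel. of_real (1 / ?n) * (autocorr f (y / ?n) * of_real (?n * sqrt (2 * pi) * exp (- (?n * (y / ?n))\<^sup>2 / 2))))"
      by (rule integral_mult_right_zero[symmetric])
    also have "\<dots> = (LINT y|lborel. autocorr f (y / ?n) * of_real (sqrt (2 * pi) * ?E y))"
      by (rule Bochner_Integration.integral_cong) (auto simp del: of_nat_Suc)
    finally show ?thesis .
  qed
  have "(\<lambda>n. LINT y|lborel. autocorr f (y / real (Suc n)) * of_real (sqrt (2 * pi) * ?E y))
      \<longlonglongrightarrow> (LINT y|lborel. autocorr f 0 * of_real (sqrt (2 * pi) * ?E y))"
  proof (rule integral_dominated_convergence[where w = "\<lambda>y. N * (sqrt (2 * pi) * ?E y)"])
    show "integrable lborel (\<lambda>y. N * (sqrt (2 * pi) * ?E y))" using Ei by simp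
    show "AE y in lborel. (\<lambda>n. autocorr f (y / real (Suc n)) * of_real (sqrt (2 * pi) * ?E y))
        \<longlonglongrightarrow> autocorr f 0 * of_real (sqrt (2 * pi) * ?E y)"
    proof (rule AE_I2)
      fix y :: real
      have "(\<lambda>n. y * inverse (real (Suc n))) \<longlonglongrightarrow> y * 0"
        by (intro tendsto_intros LIMSEQ_inverse_real_of_nat)
      then have "(\<lambda>n. y / real (Suc n)) \<longlonglongrightarrow> 0" by (simp add: divide_inverse)
      from tendsto_autocorr[OF _ fin this]
      show "(\<lambda>n. autocorr f (y / real (Suc n)) * of_real (sqrt (2 * pi) * ?E y))
        \<longlonglongrightarrow> autocorr f 0 * of_real (sqrt (2 * pi) * ?E y)"
        by (intro tendsto_mult tendsto_const) simp
    qed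
    show "AE y in lborel. norm (autocorr f (y / real (Suc n)) * of_real (sqrt (2 * pi) * ?E y)) \<le> N * (sqrt (2 * pi) * ?E y)" for n
      unfolding norm_mult N_def norm_of_real using autocorr_bound[OF _ fin] by (intro AE_I2 mult_mono) auto
  qed measurable
  also have "(LINT y|lborel. autocorr f 0 * of_real (sqrt (2 * pi) * ?E y)) = of_real (2 * pi * N)"
  proof -
    have "(LINT y|lborel. autocorr f 0 * of_real (sqrt (2 * pi) * ?E y))
       = autocorr f 0 * of_real (LINT y|lborel. sqrt (2 * pi) * ?E y)"
      by (simp only: integral_mult_right_zero integral_complex_of_real)
    also have "(LINT y|lborel. sqrt (2 * pi) * ?E y) = sqrt (2 * pi) * sqrt (2 * pi)"
      by (simp only: integral_mult_right_zero Eint)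
    finally show ?thesis by (simp add: autocorr_0 N_def)
  qed
  finally have lim: "(\<lambda>n. LINT \<xi>|lborel. complex_of_real ((norm (fourier 1 f \<xi>))\<^sup>2) * of_real (W n \<xi>)) \<longlonglongrightarrow> of_real (2 * pi * N)"
    by (simp only: eq)
  have lim2: "(\<lambda>n. LINT \<xi>|lborel. (norm (fourier 1 f \<xi>))\<^sup>2 * W n \<xi>) \<longlonglongrightarrow> 2 * pi * N"
    using tendsto_Re[OF lim] by (simp only: of_real_mult[symmetric] integral_complex_of_real Re_complex_of_real)
  have int: "integrable lborel (\<lambda>\<xi>. (norm (fourier 1 f \<xi>))\<^sup>2 * W n \<xi>)" for n
  proof (rule Bochner_Integration.integrable_bound)
    show "integrable lborel (\<lambda>\<xi>. B\<^sup>2 * W n \<xi>)" using Wint[of n] by (simp add: complex_of_real_integrable_eq)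
    show "AE \<xi> in lborel. norm ((norm (fourier 1 f \<xi>))\<^sup>2 * W n \<xi>) \<le> norm (B\<^sup>2 * W n \<xi>)"
    proof (rule AE_I2)
      fix \<xi>
      have "(norm (fourier 1 f \<xi>))\<^sup>2 \<le> B\<^sup>2" by (intro power_mono normf) auto
      then show "norm ((norm (fourier 1 f \<xi>))\<^sup>2 * W n \<xi>) \<le> norm (B\<^sup>2 * W n \<xi>)"
        by (simp add: abs_mult mult_right_mono)
    qed
  qed measurable
  have "(\<lambda>n. \<integral>\<^sup>+\<xi>. ennreal ((norm (fourier 1 f \<xi>))\<^sup>2 * W n \<xi>) \<partial>lborel) \<longlonglongrightarrow> sqnorm (fourier 1 f)"
    unfolding sqnorm_def
  proof (rule nn_integral_LIMSEQ)
    have "W m \<xi> \<le> W n \<xi>" if "m \<le> n" for m n \<xi>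
    proof -
      have "\<bar>\<xi>\<bar> / real (Suc n) \<le> \<bar>\<xi>\<bar> / real (Suc m)" using that by (intro divide_left_mono) auto
      then have "(\<bar>\<xi>\<bar> / real (Suc n))\<^sup>2 \<le> (\<bar>\<xi>\<bar> / real (Suc m))\<^sup>2" by (intro power_mono) auto
      then show ?thesis by (simp add: W_def power_divide)
    qed
    then show "incseq (\<lambda>n \<xi>. ennreal ((norm (fourier 1 f \<xi>))\<^sup>2 * W n \<xi>))"
      by (auto simp: incseq_def le_fun_def intro!: ennreal_leI mult_left_mono)
    show "(\<lambda>n. ennreal ((norm (fourier 1 f \<xi>))\<^sup>2 * W n \<xi>)) \<longlonglongrightarrow> ennreal ((norm (fourier 1 f \<xi>))\<^sup>2)" for \<xi>
    proof -
      have "(\<lambda>n. \<xi> * inverse (real (Suc n))) \<longlonglongrightarrow> \<xi> * 0"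
        by (intro tendsto_intros LIMSEQ_inverse_real_of_nat)
      then have "(\<lambda>n. \<xi> / real (Suc n)) \<longlonglongrightarrow> 0" by (simp add: divide_inverse)
      then have "(\<lambda>n. W n \<xi>) \<longlonglongrightarrow> exp (- 0\<^sup>2 / 2)" unfolding W_def by (intro tendsto_intros) auto
      then have "(\<lambda>n. ennreal ((norm (fourier 1 f \<xi>))\<^sup>2 * W n \<xi>)) \<longlonglongrightarrow> ennreal ((norm (fourier 1 f \<xi>))\<^sup>2 * 1)"
        by (intro tendsto_ennrealI tendsto_mult tendsto_const) simp
      then show ?thesis by simp
    qed
  qed measurable
  moreover have "(\<integral>\<^sup>+\<xi>. ennreal ((norm (fourier 1 f \<xi>))\<^sup>2 * W n \<xi>) \<partial>lborel) = ennreal (LINT \<xi>|lborel. (norm (fourier 1 f \<xi>))\<^sup>2 * W n \<xi>)" for n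
    by (rule nn_integral_eq_integral[OF int]) (auto simp: W_def)
  ultimately have "(\<lambda>n. ennreal (LINT \<xi>|lborel. (norm (fourier 1 f \<xi>))\<^sup>2 * W n \<xi>)) \<longlonglongrightarrow> sqnorm (fourier 1 f)" by simp
  moreover have "(\<lambda>n. ennreal (LINT \<xi>|lborel. (norm (fourier 1 f \<xi>))\<^sup>2 * W n \<xi>)) \<longlonglongrightarrow> ennreal (2 * pi * N)"
    by (intro tendsto_ennrealI lim2)
  ultimately have "sqnorm (fourier 1 f) = ennreal (2 * pi * N)" by (rule LIMSEQ_unique)
  also have "\<dots> = ennreal (2 * pi) * sqnorm f"
    by (simp add: sqnorm_finite(2)[OF _ fin] N_def ennreal_mult)
  finally show ?thesis .
qed

lemma plancherel:
  assumes f: "integrable lborel f" and fin: "sqnorm f < \<infinity>" and c: "c \<noteq> 0"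
  shows "sqnorm (fourier c f) = ennreal (2 * pi / \<bar>c\<bar>) * sqnorm f"
proof -
  have [measurable]: "f \<in> borel_measurable borel"
    using f by (auto dest: borel_measurable_integrable)
  have "fourier c f = (\<lambda>\<xi>. fourier 1 f (0 + c * \<xi>))"
    by (rule ext, subst fourier_scale) simp
  then have "sqnorm (fourier c f) = sqnorm (\<lambda>\<xi>. fourier 1 f (0 + c * \<xi>))" by simp
  also have "\<dots> = ennreal (1 / \<bar>c\<bar>) * (ennreal (2 * pi) * sqnorm f)"
    by (subst sqnorm_affine) (use c plancherel_1[OF f fin] in auto)
  also have "\<dots> = ennreal (2 * pi / \<bar>c\<bar>) * sqnorm f"
    by (simp flip: mult.assoc ennreal_mult)
  finally show ?thesis .
qed

text \<open>The upper bound holds for every integrable $f$: without square-integrability the right side is infinite.\<close>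

lemma sqnorm_fourier_le:
  assumes f: "integrable lborel f" and c: "c \<noteq> 0"
  shows "sqnorm (fourier c f) \<le> ennreal (2 * pi / \<bar>c\<bar>) * sqnorm f"
proof (cases "sqnorm f < \<infinity>")
  case True
  then show ?thesis using plancherel[OF f _ c] by simp
next
  case False
  then have "sqnorm f = top" by (simp add: less_top[symmetric])
  moreover have "ennreal (2 * pi / \<bar>c\<bar>) > 0" using c by simp
  ultimately show ?thesis using c by (simp add: ennreal_mult_top)
qed

text \<open>The $L^2$ error of inverting the Fourier transform from the frequencies in $[-R, R]$ is the mass of
  $\hat g$ outside that interval. The truncated inverse $p$ satisfies
  $\langle g, p \rangle = \|p\|_2^2$ by the multiplication formula, so
  $\|g - p\|_2^2 = \|g\|_2^2 - \|p\|_2^2$.\<close>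

lemma sqnorm_partial_inversion:
  fixes c R :: real
  assumes g: "integrable lborel g" and fin: "sqnorm g < \<infinity>" and c: "c \<noteq> 0"
  defines "h \<equiv> \<lambda>\<xi>. indicator {-R..R} \<xi> * fourier (- c) g \<xi>"
  shows "sqnorm (\<lambda>t. g t - of_real (\<bar>c\<bar> / (2 * pi)) * fourier c h t) =
    ennreal (\<bar>c\<bar> / (2 * pi)) * sqnorm (\<lambda>\<xi>. indicator (- {-R..R}) \<xi> * fourier (- c) g \<xi>)"
proof -
  define \<kappa> where "\<kappa> = \<bar>c\<bar> / (2 * pi)"
  have \<kappa>: "\<kappa> > 0" using c by (simp add: \<kappa>_def)
  have [measurable]: "g \<in> borel_measurable borel"
    using g by (auto dest: borel_measurable_integrable)
  let ?g = "fourier (- c) g"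
  define o' where "o' \<xi> = indicator (- {-R..R}) \<xi> * ?g \<xi>" for \<xi>
  define p where "p t = of_real \<kappa> * fourier c h t" for t
  have [measurable]: "h \<in> borel_measurable borel" "o' \<in> borel_measurable borel"
    unfolding h_def o'_def[abs_def] by measurable
  have [measurable]: "p \<in> borel_measurable borel"
    unfolding p_def[abs_def] by measurable
  have ghat: "sqnorm ?g = ennreal (1 / \<kappa>) * sqnorm g"
    using plancherel[OF g fin, of "- c"] c by (simp add: \<kappa>_def)
  then have ghat_fin: "sqnorm ?g < \<infinity>" using fin by (simp add: ennreal_mult_less_top)
  have "sqnorm h \<le> sqnorm ?g" "sqnorm o' \<le> sqnorm ?g"
    unfolding sqnorm_def h_def o'_def by (auto intro!: nn_integral_mono simp: indicator_def)
  then have h_fin: "sqnorm h < \<infinity>" and o_fin: "sqnorm o' < \<infinity>" using ghat_fin by auto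
  have h_int: "integrable lborel h"
  proof (rule Bochner_Integration.integrable_bound)
    show "integrable lborel (\<lambda>\<xi>. indicator {-R..R} \<xi> * (LINT t|lborel. norm (g t)))"
      by (intro integrable_mult_left integrable_real_indicator) (auto simp: emeasure_lborel_Icc_eq)
    show "AE \<xi> in lborel. norm (h \<xi>) \<le> norm (indicator {-R..R} \<xi> * (LINT t|lborel. norm (g t)))"
      using norm_fourier_le[OF g, of "- c"] by (auto intro!: AE_I2 simp: h_def indicator_def)
  qed measurable
  have p: "sqnorm p = ennreal \<kappa> * sqnorm h"
  proof -
    have "sqnorm p = ennreal (\<kappa>\<^sup>2) * (ennreal (1 / \<kappa>) * sqnorm h)"
      unfolding p_def using plancherel[OF h_int h_fin c] \<kappa> by (subst sqnorm_cmult) (auto simp: \<kappa>_def norm_divide norm_mult)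
    also have "\<dots> = ennreal (\<kappa>\<^sup>2 * (1 / \<kappa>)) * sqnorm h" using \<kappa> by (simp flip: mult.assoc ennreal_mult)
    also have "\<kappa>\<^sup>2 * (1 / \<kappa>) = \<kappa>" using \<kappa> by (simp add: power2_eq_square)
    finally show ?thesis .
  qed
  then have p_fin: "sqnorm p < \<infinity>" using h_fin by (simp add: ennreal_mult_less_top)
  let ?I = "\<lambda>f::real\<Rightarrow>complex. LINT t|lborel. (norm (f t))\<^sup>2"
  note sqg = sqnorm_finite[OF _ fin] and sqgh = sqnorm_finite[OF _ ghat_fin] and sqh = sqnorm_finite[OF _ h_fin]
    and sqo = sqnorm_finite[OF _ o_fin] and sqp = sqnorm_finite[OF _ p_fin]
  have I1: "?I ?g = 1 / \<kappa> * ?I g"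
    using ghat \<kappa> by (simp add: sqg sqgh ennreal_mult[symmetric])
  have I2: "?I p = \<kappa> * ?I h"
    using p \<kappa> by (simp add: sqh sqp ennreal_mult[symmetric])
  have I3: "?I ?g = ?I h + ?I o'"
  proof -
    have "?I h + ?I o' = (LINT t|lborel. (norm (h t))\<^sup>2 + (norm (o' t))\<^sup>2)"
      by (intro Bochner_Integration.integral_add[symmetric] sqh sqo) auto
    also have "\<dots> = ?I ?g"
      by (intro Bochner_Integration.integral_cong) (auto simp: h_def o'_def indicator_def)
    finally show ?thesis ..
  qed
  have gp: "integrable lborel (\<lambda>t. g t * cnj (p t))"
    by (intro integrable_mult_sqnorm) (use fin p_fin in \<open>auto simp: sqnorm_cnj\<close>)
  have I4: "(LINT t|lborel. g t * cnj (p t)) = of_real (\<kappa> * ?I h)"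
  proof -
    have "(LINT t|lborel. g t * cnj (p t)) = (LINT t|lborel. of_real \<kappa> * (g t * fourier (- c) (\<lambda>\<xi>. cnj (h \<xi>)) t))"
      by (simp add: p_def cnj_fourier mult_ac)
    also have "\<dots> = of_real \<kappa> * (LINT t|lborel. g t * fourier (- c) (\<lambda>\<xi>. cnj (h \<xi>)) t)"
      by (rule integral_mult_right_zero)
    also have "(LINT t|lborel. g t * fourier (- c) (\<lambda>\<xi>. cnj (h \<xi>)) t) = (LINT \<xi>|lborel. ?g \<xi> * cnj (h \<xi>))"
      using fourier_multiplication_formula[OF g, of "\<lambda>\<xi>. cnj (h \<xi>)" "- c"] h_int by simp
    also have "\<dots> = (LINT \<xi>|lborel. complex_of_real ((norm (h \<xi>))\<^sup>2))"
      by (intro Bochner_Integration.integral_cong refl) (auto simp: h_def indicator_def complex_norm_square simp del: of_real_power)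
    finally show ?thesis by (simp only: integral_complex_of_real of_real_mult)
  qed
  \<comment> \<open>expand $\|g - p\|_2^2$ into the norms and the inner product computed above\<close>
  have expand: "(norm (g t - p t))\<^sup>2 = ((norm (g t))\<^sup>2 + (norm (p t))\<^sup>2) - 2 * Re (g t * cnj (p t))" for t
    unfolding cmod_power2 by (simp add: power2_eq_square algebra_simps)
  have I5: "?I (\<lambda>t. g t - p t) = \<kappa> * ?I o'" and int5: "integrable lborel (\<lambda>t. (norm (g t - p t))\<^sup>2)"
  proof -
    have i1: "integrable lborel (\<lambda>t. (norm (g t))\<^sup>2 + (norm (p t))\<^sup>2)" using sqg(1) sqp(1) by simp
    have i2: "integrable lborel (\<lambda>t. 2 * Re (g t * cnj (p t)))" using gp by (intro integrable_mult_right integrable_Re)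
    show "integrable lborel (\<lambda>t. (norm (g t - p t))\<^sup>2)"
      unfolding expand by (intro Bochner_Integration.integrable_diff i1 i2)
    have "?I (\<lambda>t. g t - p t) = (?I g + ?I p) - 2 * Re (LINT t|lborel. g t * cnj (p t))"
    proof -
      have "(LINT t|lborel. 2 * Re (g t * cnj (p t))) = 2 * Re (LINT t|lborel. g t * cnj (p t))"
        by (simp only: integral_mult_right_zero integral_Re[OF gp])
      moreover have "(LINT t|lborel. (norm (g t))\<^sup>2 + (norm (p t))\<^sup>2) = ?I g + ?I p"
        using sqg(1) sqp(1) by simp
      ultimately show ?thesis
        unfolding expand by (simp only: Bochner_Integration.integral_diff[OF i1 i2])
    qed
    also have "\<dots> = \<kappa> * ?I ?g + \<kappa> * ?I h - 2 * (\<kappa> * ?I h)"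
      using I1 \<kappa> by (simp only: I4 Re_complex_of_real I2) simp
    also have "\<dots> = \<kappa> * ?I o'" by (simp add: I3 algebra_simps)
    finally show "?I (\<lambda>t. g t - p t) = \<kappa> * ?I o'" .
  qed
  have "sqnorm (\<lambda>t. g t - p t) = ennreal (?I (\<lambda>t. g t - p t))"
    unfolding sqnorm_def by (rule nn_integral_eq_integral[OF int5]) auto
  also have "\<dots> = ennreal \<kappa> * sqnorm o'"
    using \<kappa> by (simp add: I5 sqo ennreal_mult)
  finally show ?thesis by (simp add: p_def o'_def[abs_def] \<kappa>_def)
qed

section \<open>Partial Fourier transforms of functions of two variables\<close>

lemma nn_integral_tail_tendsto_0:
  fixes u :: "real \<Rightarrow> ennreal" and R :: "nat \<Rightarrow> real"
  assumes [measurable]: "u \<in> borel_measurable borel" and fin: "(\<integral>\<^sup>+t. u t \<partial>lborel) < \<infinity>"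
    and R: "filterlim R at_top sequentially"
  shows "(\<lambda>n. \<integral>\<^sup>+t. indicator (- {- R n..R n}) t * u t \<partial>lborel) \<longlonglongrightarrow> 0"
proof -
  have "(\<lambda>n. \<integral>\<^sup>+t. indicator (- {- R n..R n}) t * u t \<partial>lborel) \<longlonglongrightarrow> (\<integral>\<^sup>+t. 0 \<partial>(lborel::real measure))"
  proof (rule nn_integral_dominated_convergence[where w = u])
    show "AE t in lborel. indicator (- {- R n..R n}) t * u t \<le> u t" for n
      by (auto simp: indicator_def)
    show "AE t in lborel. (\<lambda>n. indicator (- {- R n..R n}) t * u t) \<longlonglongrightarrow> 0"
    proof (rule AE_I2)
      fix t :: real
      have "eventually (\<lambda>n. \<bar>t\<bar> \<le> R n) sequentially"
        using R by (simp add: filterlim_at_top)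
      then have "eventually (\<lambda>n. indicator (- {- R n..R n}) t * u t = 0) sequentially"
        by eventually_elim (auto simp: indicator_def)
      then show "(\<lambda>n. indicator (- {- R n..R n}) t * u t) \<longlonglongrightarrow> 0" by (rule tendsto_eventually)
    qed
  qed (use fin in auto)
  then show ?thesis by simp
qed

lemma integral_lebesgue_pair:
  fixes f :: "real \<times> real \<Rightarrow> 'a::{banach, second_countable_topology}"
  assumes "f \<in> borel_measurable (borel \<Otimes>\<^sub>M borel)"
  shows "integral\<^sup>L lebesgue f = integral\<^sup>L (lborel \<Otimes>\<^sub>M lborel) f"
    and "integrable lebesgue f \<longleftrightarrow> integrable (lborel \<Otimes>\<^sub>M lborel) f"
proof -
  have f: "f \<in> borel_measurable lborel" using assms by (simp add: borel_prod)
  show "integral\<^sup>L lebesgue f = integral\<^sup>L (lborel \<Otimes>\<^sub>M lborel) f"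
    using integral_completion[OF f] by (simp add: lborel_prod)
  show "integrable lebesgue f \<longleftrightarrow> integrable (lborel \<Otimes>\<^sub>M lborel) f"
    using integrable_completion[OF f] by (simp add: lborel_prod)
qed

lemma nn_integral_pair_sqnorm:
  fixes f :: "real \<Rightarrow> real \<Rightarrow> complex"
  assumes [measurable]: "case_prod f \<in> borel_measurable (borel \<Otimes>\<^sub>M borel)"
  shows "(\<integral>\<^sup>+p. ennreal ((norm (case_prod f p))\<^sup>2) \<partial>(lborel \<Otimes>\<^sub>M lborel)) = (\<integral>\<^sup>+t. sqnorm (f t) \<partial>lborel)"
  unfolding sqnorm_def by (subst lborel.nn_integral_fst[symmetric]) auto

lemma L2_pairI:
  fixes f :: "real \<Rightarrow> real \<Rightarrow> complex"
  assumes [measurable]: "case_prod f \<in> borel_measurable (borel \<Otimes>\<^sub>M borel)"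
    and fin: "(\<integral>\<^sup>+t. sqnorm (f t) \<partial>lborel) < \<infinity>"
  shows "case_prod f \<in> L2"
proof -
  have "case_prod f \<in> borel_measurable lborel" using assms(1) by (simp add: borel_prod)
  then have "case_prod f \<in> borel_measurable lebesgue" by (rule measurable_completion)
  moreover have "integrable (lborel \<Otimes>\<^sub>M lborel) (\<lambda>p. (norm (case_prod f p))\<^sup>2)"
    unfolding integrable_iff_bounded using fin nn_integral_pair_sqnorm[OF assms(1)] by simp
  ultimately show ?thesis unfolding L2_def
    using integral_lebesgue_pair(2)[of "\<lambda>p. (norm (case_prod f p))\<^sup>2"] by simp
qed

text \<open>A square-integrable function $G(t, \tau)$ on the plane all of whose sections, in either variable, are
  integrable, so that both partial Fourier integrals exist at every point; $c$ is the frequency scale.\<close>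

locale partial_fourier =
  fixes G :: "real \<Rightarrow> real \<Rightarrow> complex" and c :: real
  assumes c: "c \<noteq> 0"
    and G_measurable [measurable]: "case_prod G \<in> borel_measurable (borel \<Otimes>\<^sub>M borel)"
    and G_fin: "(\<integral>\<^sup>+t. sqnorm (G t) \<partial>lborel) < \<infinity>"
    and row: "\<And>t. integrable lborel (G t)"
    and col: "\<And>\<tau>. integrable lborel (\<lambda>t. G t \<tau>)"
begin

text \<open>The constant in the inversion formula for \<^const>\<open>fourier\<close> at scale $c$.\<close>

definition "\<kappa> = \<bar>c\<bar> / (2 * pi)"

text \<open>The transform in the first variable, normalised so that \<^term>\<open>fourier c\<close> inverts it.\<close>

definition A :: "real \<Rightarrow> real \<Rightarrow> complex" where
  "A \<tau> z = of_real \<kappa> * fourier (- c) (\<lambda>t. G t \<tau>) z"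

text \<open>The transform in the second variable.\<close>

definition W :: "real \<Rightarrow> real \<Rightarrow> complex" where
  "W t u = fourier (- c) (G t) u"

text \<open>$G$ reconstructed from the values of \<^const>\<open>A\<close> on the square $[-R, R]^2$: truncated in $\tau$, and
  inverted in $t$ from the frequencies in $[-R, R]$ only.\<close>

definition D :: "real \<Rightarrow> real \<Rightarrow> real \<Rightarrow> complex" where
  "D R t \<tau> = indicator {-R..R} \<tau> *
     (of_real \<kappa> * fourier c (\<lambda>z. indicator {-R..R} z * fourier (- c) (\<lambda>t. G t \<tau>) z) t)"

text \<open>The two-dimensional Fourier integral of \<^const>\<open>A\<close> over $[-R, R]^2$, written as a transform in one variable
  of \<^const>\<open>D\<close>; lemma \<open>T_eq\<close> identifies the two.\<close>

definition T :: "real \<Rightarrow> real \<Rightarrow> real \<Rightarrow> complex" where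
  "T R t u = fourier (- c) (D R t) u"

lemma \<kappa>_pos: "\<kappa> > 0" using c by (simp add: \<kappa>_def)

lemma A_measurable [measurable]: "case_prod A \<in> borel_measurable (borel \<Otimes>\<^sub>M borel)"
  unfolding A_def[abs_def] by measurable

lemma W_measurable [measurable]: "case_prod W \<in> borel_measurable (borel \<Otimes>\<^sub>M borel)"
  unfolding W_def[abs_def] by measurable

lemma D_measurable [measurable]: "case_prod (D R) \<in> borel_measurable (borel \<Otimes>\<^sub>M borel)"
  unfolding D_def[abs_def] by measurable

lemma T_measurable [measurable]: "case_prod (T R) \<in> borel_measurable (borel \<Otimes>\<^sub>M borel)"
  unfolding T_def[abs_def] by measurable

lemma G_fin_swap: "(\<integral>\<^sup>+\<tau>. sqnorm (\<lambda>t. G t \<tau>) \<partial>lborel) < \<infinity>"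
proof -
  have "(\<integral>\<^sup>+t. sqnorm (G t) \<partial>lborel) = (\<integral>\<^sup>+\<tau>. sqnorm (\<lambda>t. G t \<tau>) \<partial>lborel)"
    unfolding sqnorm_def by (rule lborel_pair.Fubini'[symmetric]) measurable
  then show ?thesis using G_fin by simp
qed

lemma AE_col_sqnorm: "AE \<tau> in lborel. sqnorm (\<lambda>t. G t \<tau>) < \<infinity>"
proof -
  have "AE \<tau> in lborel. sqnorm (\<lambda>t. G t \<tau>) \<noteq> \<infinity>"
  proof (rule nn_integral_noteq_infinite)
    show "(\<lambda>\<tau>. sqnorm (\<lambda>t. G t \<tau>)) \<in> borel_measurable lborel" unfolding sqnorm_def by measurable
  qed (use G_fin_swap in simp)
  then show ?thesis by (simp add: less_top)
qed

lemma sqnorm_A: "sqnorm (A \<tau>) \<le> ennreal \<kappa> * sqnorm (\<lambda>t. G t \<tau>)"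
proof -
  have [measurable]: "(\<lambda>t. G t \<tau>) \<in> borel_measurable borel" by measurable
  have "sqnorm (A \<tau>) = ennreal (\<kappa>\<^sup>2) * sqnorm (fourier (- c) (\<lambda>t. G t \<tau>))"
    unfolding A_def by (subst sqnorm_cmult) auto
  also have "\<dots> \<le> ennreal (\<kappa>\<^sup>2) * (ennreal (1 / \<kappa>) * sqnorm (\<lambda>t. G t \<tau>))"
    using sqnorm_fourier_le[OF col, of "- c"] c by (intro mult_left_mono) (auto simp: \<kappa>_def)
  also have "\<dots> = ennreal (\<kappa>\<^sup>2 * (1 / \<kappa>)) * sqnorm (\<lambda>t. G t \<tau>)"
    using \<kappa>_pos by (simp flip: mult.assoc ennreal_mult)
  also have "\<kappa>\<^sup>2 * (1 / \<kappa>) = \<kappa>" using \<kappa>_pos by (simp add: power2_eq_square)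
  finally show ?thesis .
qed

lemma A_fin: "(\<integral>\<^sup>+\<tau>. sqnorm (A \<tau>) \<partial>lborel) < \<infinity>"
proof -
  have "(\<integral>\<^sup>+\<tau>. sqnorm (A \<tau>) \<partial>lborel) \<le> (\<integral>\<^sup>+\<tau>. ennreal \<kappa> * sqnorm (\<lambda>t. G t \<tau>) \<partial>lborel)"
    by (intro nn_integral_mono sqnorm_A)
  also have "\<dots> = ennreal \<kappa> * (\<integral>\<^sup>+\<tau>. sqnorm (\<lambda>t. G t \<tau>) \<partial>lborel)"
    unfolding sqnorm_def by (rule nn_integral_cmult) measurable
  also have "\<dots> < \<infinity>" using G_fin_swap by (simp add: ennreal_mult_less_top)
  finally show ?thesis .
qed

lemma W_fin: "(\<integral>\<^sup>+t. sqnorm (W t) \<partial>lborel) < \<infinity>"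
proof -
  have "(\<integral>\<^sup>+t. sqnorm (W t) \<partial>lborel) \<le> (\<integral>\<^sup>+t. ennreal (2 * pi / \<bar>- c\<bar>) * sqnorm (G t) \<partial>lborel)"
    unfolding W_def using c by (intro nn_integral_mono sqnorm_fourier_le row) auto
  also have "\<dots> = ennreal (2 * pi / \<bar>- c\<bar>) * (\<integral>\<^sup>+t. sqnorm (G t) \<partial>lborel)"
    unfolding sqnorm_def by (rule nn_integral_cmult) measurable
  also have "\<dots> < \<infinity>" using G_fin by (simp add: ennreal_mult_less_top)
  finally show ?thesis .
qed

lemma A_square_integrable_on:
  "integrable (lborel \<Otimes>\<^sub>M lborel) (\<lambda>(\<tau>, z). indicator ({-R..R} \<times> {-R..R}) (\<tau>, z) * A \<tau> z)"
proof (rule Bochner_Integration.integrable_bound)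
  have "(\<integral>\<^sup>+p. ennreal ((norm (A (fst p) (snd p)))\<^sup>2) \<partial>(lborel \<Otimes>\<^sub>M lborel)) = (\<integral>\<^sup>+\<tau>. sqnorm (A \<tau>) \<partial>lborel)"
    unfolding sqnorm_def by (subst lborel.nn_integral_fst[symmetric]) auto
  then have 1: "integrable (lborel \<Otimes>\<^sub>M lborel) (\<lambda>p. (norm (A (fst p) (snd p)))\<^sup>2)"
    using A_fin unfolding integrable_iff_bounded by simp
  have "emeasure (lborel \<Otimes>\<^sub>M lborel) ({-R..R} \<times> {-R..R}) < \<infinity>"
    by (subst lborel.emeasure_pair_measure_Times) (auto simp: emeasure_lborel_Icc_eq ennreal_mult_less_top)
  then have 2: "integrable (lborel \<Otimes>\<^sub>M lborel) (indicator ({-R..R} \<times> {-R..R}) :: _ \<Rightarrow> real)"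
    by (intro integrable_real_indicator) auto
  show "integrable (lborel \<Otimes>\<^sub>M lborel) (\<lambda>p. indicator ({-R..R} \<times> {-R..R}) p + (norm (A (fst p) (snd p)))\<^sup>2)"
    by (intro Bochner_Integration.integrable_add 1 2)
  \<comment> \<open>the square has finite measure, and $|A| \leq 1 + |A|^2$\<close>
  have "x \<le> 1 + x\<^sup>2" for x :: real
    using zero_le_power2[of "x - 1 / 2"] by (simp add: power2_eq_square algebra_simps)
  then have *: "norm (indicator ({-R..R} \<times> {-R..R}) p * A (fst p) (snd p))
     \<le> indicator ({-R..R} \<times> {-R..R}) p + (norm (A (fst p) (snd p)))\<^sup>2" for p
    by (cases "p \<in> {-R..R} \<times> {-R..R}") simp_all
  show "AE p in lborel \<Otimes>\<^sub>M lborel. norm (case p of (\<tau>, z) \<Rightarrow> indicator ({-R..R} \<times> {-R..R}) (\<tau>, z) * A \<tau> z)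
     \<le> norm (indicator ({-R..R} \<times> {-R..R}) p + (norm (A (fst p) (snd p)))\<^sup>2)"
    by (rule AE_I2) (use * in \<open>simp add: case_prod_unfold\<close>)
qed measurable

lemma
  shows D_integrable: "integrable lborel (D R t)"
    and T_eq: "T R t u = (LINT (\<tau>, z)|(lborel \<Otimes>\<^sub>M lborel).
       indicator ({-R..R} \<times> {-R..R}) (\<tau>, z) * A \<tau> z * exp (\<i> * of_real ((z * t - u * \<tau>) * c)))"
proof -
  let ?h = "\<lambda>u \<tau> z. indicator ({-R..R} \<times> {-R..R}) (\<tau>, z) * A \<tau> z * exp (\<i> * of_real ((z * t - u * \<tau>) * c))"
  have int: "integrable (lborel \<Otimes>\<^sub>M lborel) (case_prod (?h u))" for u
  proof -
    have "integrable (lborel \<Otimes>\<^sub>M lborel) (\<lambda>p. (case p of (\<tau>, z) \<Rightarrow> indicator ({-R..R} \<times> {-R..R}) (\<tau>, z) * A \<tau> z)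
        * exp (\<i> * of_real ((snd p * t - u * fst p) * c)))"
      by (intro integrable_mult_exp A_square_integrable_on) measurable
    then show ?thesis by (simp only: case_prod_unfold)
  qed
  have inner: "(LINT z|lborel. ?h u \<tau> z) = D R t \<tau> * exp (\<i> * of_real (- c * \<tau> * u))" for u \<tau>
  proof -
    have "?h u \<tau> z = (indicator {-R..R} \<tau> * of_real \<kappa> * exp (\<i> * of_real (- c * \<tau> * u))) *
       (indicator {-R..R} z * fourier (- c) (\<lambda>t. G t \<tau>) z * exp (\<i> * of_real (c * z * t)))" for z
    proof -
      have "exp (\<i> * of_real ((z * t - u * \<tau>) * c)) = exp (\<i> * of_real (- c * \<tau> * u)) * exp (\<i> * of_real (c * z * t))"
        unfolding exp_add[symmetric] by (simp add: algebra_simps)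
      then show ?thesis by (simp only: A_def indicator_times fst_conv snd_conv mult_ac)
    qed
    then show ?thesis
      by (simp only: integral_mult_right_zero) (simp add: D_def fourier_def)
  qed
  show "integrable lborel (D R t)"
    using lborel_pair.integrable_fst[OF int[of 0]] by (simp only: inner) simp
  show "T R t u = (LINT (\<tau>, z)|(lborel \<Otimes>\<^sub>M lborel).
       indicator ({-R..R} \<times> {-R..R}) (\<tau>, z) * A \<tau> z * exp (\<i> * of_real ((z * t - u * \<tau>) * c)))"
    using lborel_pair.integral_fst[OF int[of u]] by (simp only: inner T_def fourier_def)
qed

text \<open>A bound for $\|T_R - W\|_2^2$: the mass of $G$ over $|\tau| > R$ and the mass of \<^const>\<open>A\<close> over
  $|z| > R$, up to constants.\<close>

definition err :: "real \<Rightarrow> ennreal" where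
  "err R = ennreal (1 / \<kappa>) * ((\<integral>\<^sup>+\<tau>. indicator (- {-R..R}) \<tau> * sqnorm (\<lambda>t. G t \<tau>) \<partial>lborel)
     + ennreal (1 / \<kappa>) * (\<integral>\<^sup>+\<tau>. \<integral>\<^sup>+z. indicator (- {-R..R}) z * ennreal ((norm (A \<tau> z))\<^sup>2) \<partial>lborel \<partial>lborel))"

lemma err_bound:
  "(\<integral>\<^sup>+t. sqnorm (\<lambda>u. T R t u - W t u) \<partial>lborel) \<le> err R"
proof -
  have "sqnorm (\<lambda>u. T R t u - W t u) \<le> ennreal (1 / \<kappa>) * sqnorm (\<lambda>\<tau>. D R t \<tau> - G t \<tau>)" for t
  proof -
    have "(\<lambda>u. T R t u - W t u) = fourier (- c) (\<lambda>\<tau>. D R t \<tau> - G t \<tau>)"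
      by (rule ext) (simp add: T_def W_def fourier_diff[OF D_integrable row])
    then show ?thesis
      using sqnorm_fourier_le[of "\<lambda>\<tau>. D R t \<tau> - G t \<tau>" "- c"] D_integrable row c by (simp add: \<kappa>_def)
  qed
  then have "(\<integral>\<^sup>+t. sqnorm (\<lambda>u. T R t u - W t u) \<partial>lborel)
      \<le> (\<integral>\<^sup>+t. ennreal (1 / \<kappa>) * sqnorm (\<lambda>\<tau>. D R t \<tau> - G t \<tau>) \<partial>lborel)"
    by (intro nn_integral_mono)
  also have "\<dots> = ennreal (1 / \<kappa>) * (\<integral>\<^sup>+t. sqnorm (\<lambda>\<tau>. D R t \<tau> - G t \<tau>) \<partial>lborel)"
    unfolding sqnorm_def by (rule nn_integral_cmult) measurable
  also have "(\<integral>\<^sup>+t. sqnorm (\<lambda>\<tau>. D R t \<tau> - G t \<tau>) \<partial>lborel) = (\<integral>\<^sup>+\<tau>. sqnorm (\<lambda>t. D R t \<tau> - G t \<tau>) \<partial>lborel)"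
    unfolding sqnorm_def by (rule lborel_pair.Fubini'[symmetric]) measurable
  also have "\<dots> \<le> (\<integral>\<^sup>+\<tau>. indicator (- {-R..R}) \<tau> * sqnorm (\<lambda>t. G t \<tau>) +
      ennreal (1 / \<kappa>) * (\<integral>\<^sup>+z. indicator (- {-R..R}) z * ennreal ((norm (A \<tau> z))\<^sup>2) \<partial>lborel) \<partial>lborel)"
  proof (rule nn_integral_mono_AE)
    from AE_col_sqnorm show "AE \<tau> in lborel. sqnorm (\<lambda>t. D R t \<tau> - G t \<tau>) \<le> indicator (- {-R..R}) \<tau> * sqnorm (\<lambda>t. G t \<tau>) +
      ennreal (1 / \<kappa>) * (\<integral>\<^sup>+z. indicator (- {-R..R}) z * ennreal ((norm (A \<tau> z))\<^sup>2) \<partial>lborel)"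
    proof eventually_elim
      case (elim \<tau>)
      show ?case
      proof (cases "\<tau> \<in> {-R..R}")
        case False
        then have "(\<lambda>t. D R t \<tau> - G t \<tau>) = (\<lambda>t. - G t \<tau>)" by (auto simp: D_def)
        with False show ?thesis by (simp add: sqnorm_minus)
      next
        case True
        let ?g = "fourier (- c) (\<lambda>t. G t \<tau>)"
        \<comment> \<open>here $D_R(\cdot, \tau)$ is the truncated inverse of the transform of $G(\cdot, \tau)$\<close>
        have "sqnorm (\<lambda>t. D R t \<tau> - G t \<tau>) = sqnorm (\<lambda>t. G t \<tau> - of_real (\<bar>c\<bar> / (2 * pi)) *
            fourier c (\<lambda>\<xi>. indicator {-R..R} \<xi> * ?g \<xi>) t)"
          using True by (subst sqnorm_commute) (simp add: D_def \<kappa>_def)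
        also have "\<dots> = ennreal \<kappa> * sqnorm (\<lambda>\<xi>. indicator (- {-R..R}) \<xi> * ?g \<xi>)"
          unfolding \<kappa>_def by (rule sqnorm_partial_inversion[OF col elim c])
        also have "sqnorm (\<lambda>\<xi>. indicator (- {-R..R}) \<xi> * ?g \<xi>) =
            (\<integral>\<^sup>+z. ennreal (1 / \<kappa>\<^sup>2) * (indicator (- {-R..R}) z * ennreal ((norm (A \<tau> z))\<^sup>2)) \<partial>lborel)"
          unfolding sqnorm_def
        proof (rule nn_integral_cong)
          fix z
          have "(norm (?g z))\<^sup>2 = 1 / \<kappa>\<^sup>2 * (norm (A \<tau> z))\<^sup>2"
            using \<kappa>_pos by (simp add: A_def norm_mult power_mult_distrib)
          then show "ennreal ((norm (indicator (- {-R..R}) z * ?g z))\<^sup>2) =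
             ennreal (1 / \<kappa>\<^sup>2) * (indicator (- {-R..R}) z * ennreal ((norm (A \<tau> z))\<^sup>2))"
            by (auto simp: indicator_def ennreal_mult[symmetric])
        qed
        also have "\<dots> = ennreal (1 / \<kappa>\<^sup>2) * (\<integral>\<^sup>+z. indicator (- {-R..R}) z * ennreal ((norm (A \<tau> z))\<^sup>2) \<partial>lborel)"
          by (rule nn_integral_cmult) measurable
        also have "ennreal \<kappa> * \<dots> = ennreal (\<kappa> * (1 / \<kappa>\<^sup>2)) * (\<integral>\<^sup>+z. indicator (- {-R..R}) z * ennreal ((norm (A \<tau> z))\<^sup>2) \<partial>lborel)"
          using \<kappa>_pos by (subst ennreal_mult) (auto simp: mult.assoc)
        also have "\<kappa> * (1 / \<kappa>\<^sup>2) = 1 / \<kappa>" using \<kappa>_pos by (simp add: power2_eq_square)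
        finally show ?thesis by simp
      qed
    qed
  qed
  also have "\<dots> = (\<integral>\<^sup>+\<tau>. indicator (- {-R..R}) \<tau> * sqnorm (\<lambda>t. G t \<tau>) \<partial>lborel)
     + ennreal (1 / \<kappa>) * (\<integral>\<^sup>+\<tau>. \<integral>\<^sup>+z. indicator (- {-R..R}) z * ennreal ((norm (A \<tau> z))\<^sup>2) \<partial>lborel \<partial>lborel)"
    unfolding sqnorm_def by (subst nn_integral_add, measurable) (subst nn_integral_cmult, measurable)
  finally show ?thesis unfolding err_def by (simp add: mult_left_mono)
qed

lemma err_fin: "err R < \<infinity>"
proof -
  have "(\<integral>\<^sup>+\<tau>. indicator (- {-R..R}) \<tau> * sqnorm (\<lambda>t. G t \<tau>) \<partial>lborel) \<le> (\<integral>\<^sup>+\<tau>. sqnorm (\<lambda>t. G t \<tau>) \<partial>lborel)"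
    "(\<integral>\<^sup>+\<tau>. \<integral>\<^sup>+z. indicator (- {-R..R}) z * ennreal ((norm (A \<tau> z))\<^sup>2) \<partial>lborel \<partial>lborel) \<le> (\<integral>\<^sup>+\<tau>. sqnorm (A \<tau>) \<partial>lborel)"
    unfolding sqnorm_def by (auto intro!: nn_integral_mono simp: indicator_def)
  then show ?thesis using G_fin_swap A_fin
    unfolding err_def by (auto simp: ennreal_mult_less_top)
qed

lemma err_tendsto_0:
  assumes R: "filterlim R at_top sequentially"
  shows "(\<lambda>n. err (R n)) \<longlonglongrightarrow> 0"
proof -
  have m: "(\<lambda>\<tau>. sqnorm (A \<tau>)) \<in> borel_measurable lborel" unfolding sqnorm_def by measurable
  have 1: "(\<lambda>n. \<integral>\<^sup>+\<tau>. indicator (- {-R n..R n}) \<tau> * sqnorm (\<lambda>t. G t \<tau>) \<partial>lborel) \<longlonglongrightarrow> 0"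
    by (rule nn_integral_tail_tendsto_0[OF _ G_fin_swap R]) (unfold sqnorm_def, measurable)
  have "(\<lambda>n. \<integral>\<^sup>+\<tau>. \<integral>\<^sup>+z. indicator (- {-R n..R n}) z * ennreal ((norm (A \<tau> z))\<^sup>2) \<partial>lborel \<partial>lborel)
      \<longlonglongrightarrow> (\<integral>\<^sup>+\<tau>. 0 \<partial>(lborel::real measure))"
  proof (rule nn_integral_dominated_convergence[where w = "\<lambda>\<tau>. sqnorm (A \<tau>)"])
    show "AE \<tau> in lborel. (\<integral>\<^sup>+z. indicator (- {-R n..R n}) z * ennreal ((norm (A \<tau> z))\<^sup>2) \<partial>lborel) \<le> sqnorm (A \<tau>)" for n
      unfolding sqnorm_def by (auto intro!: AE_I2 nn_integral_mono simp: indicator_def)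
    have "AE \<tau> in lborel. sqnorm (A \<tau>) \<noteq> \<infinity>"
      by (rule nn_integral_noteq_infinite[OF m]) (use A_fin in simp)
    then show "AE \<tau> in lborel. (\<lambda>n. \<integral>\<^sup>+z. indicator (- {-R n..R n}) z * ennreal ((norm (A \<tau> z))\<^sup>2) \<partial>lborel) \<longlonglongrightarrow> 0"
    proof eventually_elim
      case (elim \<tau>)
      then have "(\<integral>\<^sup>+z. ennreal ((norm (A \<tau> z))\<^sup>2) \<partial>lborel) < \<infinity>" by (simp add: sqnorm_def less_top)
      from nn_integral_tail_tendsto_0[OF _ this R] show ?case by simp
    qed
    show "(\<lambda>\<tau>. sqnorm (A \<tau>)) \<in> borel_measurable lborel" by (rule m)
  qed (use A_fin in auto)
  then have 2: "(\<lambda>n. \<integral>\<^sup>+\<tau>. \<integral>\<^sup>+z. indicator (- {-R n..R n}) z * ennreal ((norm (A \<tau> z))\<^sup>2) \<partial>lborel \<partial>lborel) \<longlonglongrightarrow> 0"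
    by simp
  have "(\<lambda>n. (\<integral>\<^sup>+\<tau>. indicator (- {-R n..R n}) \<tau> * sqnorm (\<lambda>t. G t \<tau>) \<partial>lborel)
     + ennreal (1 / \<kappa>) * (\<integral>\<^sup>+\<tau>. \<integral>\<^sup>+z. indicator (- {-R n..R n}) z * ennreal ((norm (A \<tau> z))\<^sup>2) \<partial>lborel \<partial>lborel)) \<longlonglongrightarrow> 0 + 0"
    by (intro tendsto_add 1 tendsto_0_mult_left_ennreal 2) simp
  then show ?thesis unfolding err_def
    by (intro tendsto_0_mult_left_ennreal) simp_all
qed

lemma fourier2_on_A:
  assumes "csc \<theta> = c"
  shows "fourier2_on \<theta> ({-R..R} \<times> {-R..R}) A = T R"
proof (intro ext)
  fix t u
  have "fourier2_on \<theta> ({-R..R} \<times> {-R..R}) A t u = (LINT (\<tau>, z)|lebesgue.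
       indicator ({-R..R} \<times> {-R..R}) (\<tau>, z) * A \<tau> z * exp (\<i> * of_real ((z * t - u * \<tau>) * c)))"
    unfolding fourier2_on_def set_lebesgue_integral_def assms
    by (intro Bochner_Integration.integral_cong) (auto simp: indicator_def split: prod.split)
  also have "\<dots> = T R t u"
    unfolding T_eq by (rule integral_lebesgue_pair) measurable
  finally show "fourier2_on \<theta> ({-R..R} \<times> {-R..R}) A t u = T R t u" .
qed

lemma T_fin: "(\<integral>\<^sup>+t. sqnorm (T R t) \<partial>lborel) < \<infinity>"
proof -
  have "(\<integral>\<^sup>+t. sqnorm (T R t) \<partial>lborel) \<le> (\<integral>\<^sup>+t. 2 * sqnorm (\<lambda>u. T R t u - W t u) + 2 * sqnorm (W t) \<partial>lborel)"
  proof (intro nn_integral_mono)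
    fix t
    show "sqnorm (T R t) \<le> 2 * sqnorm (\<lambda>u. T R t u - W t u) + 2 * sqnorm (W t)"
      using sqnorm_add_le[of "\<lambda>u. T R t u - W t u" "W t"] by simp
  qed
  also have "\<dots> = 2 * (\<integral>\<^sup>+t. sqnorm (\<lambda>u. T R t u - W t u) \<partial>lborel) + 2 * (\<integral>\<^sup>+t. sqnorm (W t) \<partial>lborel)"
    unfolding sqnorm_def by (subst nn_integral_add, measurable) (simp add: nn_integral_cmult)
  also have "\<dots> < \<infinity>"
    using W_fin le_less_trans[OF err_bound err_fin] by (simp add: ennreal_mult_less_top)
  finally show ?thesis .
qed

lemma has_L2_fourier2_A:
  assumes "csc \<theta> = c"
  shows "has_L2_fourier2 \<theta> A W"
  unfolding has_L2_fourier2_def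
proof (intro conjI allI)
  show "case_prod A \<in> L2" by (intro L2_pairI A_fin) measurable
  show "case_prod W \<in> L2" by (intro L2_pairI W_fin) measurable
  show "case_prod (fourier2_on \<theta> ({-R..R} \<times> {-R..R}) A) \<in> L2" for R
    unfolding fourier2_on_A[OF assms] by (intro L2_pairI T_fin) measurable
  show "((\<lambda>R. LINT (t, u)|lebesgue. (norm (fourier2_on \<theta> ({-R..R} \<times> {-R..R}) A t u - W t u))\<^sup>2) \<longlongrightarrow> 0) at_top"
    unfolding fourier2_on_A[OF assms]
  proof (rule tendsto_at_topI_sequentially)
    fix R :: "nat \<Rightarrow> real" assume R: "filterlim R at_top sequentially"
    have eq: "(LINT (t, u)|lebesgue. (norm (T r t u - W t u))\<^sup>2) = enn2real (\<integral>\<^sup>+t. sqnorm (\<lambda>u. T r t u - W t u) \<partial>lborel)" for r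
    proof -
      have "(LINT (t, u)|lebesgue. (norm (T r t u - W t u))\<^sup>2)
          = (LINT p|(lborel \<Otimes>\<^sub>M lborel). (norm ((\<lambda>(t, u). T r t u - W t u) p))\<^sup>2)"
        by (subst integral_lebesgue_pair) (auto simp: case_prod_unfold)
      also have "\<dots> = enn2real (\<integral>\<^sup>+p. ennreal ((norm ((\<lambda>(t, u). T r t u - W t u) p))\<^sup>2) \<partial>(lborel \<Otimes>\<^sub>M lborel))"
        by (rule integral_eq_nn_integral) auto
      also have "(\<integral>\<^sup>+p. ennreal ((norm ((\<lambda>(t, u). T r t u - W t u) p))\<^sup>2) \<partial>(lborel \<Otimes>\<^sub>M lborel)) = (\<integral>\<^sup>+t. sqnorm (\<lambda>u. T r t u - W t u) \<partial>lborel)"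
        by (rule nn_integral_pair_sqnorm) measurable
      finally show ?thesis .
    qed
    have "(\<lambda>n. err (R n)) \<longlonglongrightarrow> ennreal 0" using err_tendsto_0[OF R] by simp
    then have "(\<lambda>n. enn2real (err (R n))) \<longlonglongrightarrow> 0" by (rule tendsto_enn2real) simp
    then show "(\<lambda>n. LINT (t, u)|lebesgue. (norm (T (R n) t u - W t u))\<^sup>2) \<longlonglongrightarrow> 0"
      unfolding eq
    proof (rule tendsto_sandwich[OF _ _ tendsto_const, rotated 2])
      show "eventually (\<lambda>n. enn2real (\<integral>\<^sup>+t. sqnorm (\<lambda>u. T (R n) t u - W t u) \<partial>lborel) \<le> enn2real (err (R n))) sequentially"
        using err_fin by (intro always_eventually allI enn2real_mono err_bound) simp
    qed simp
  qed
qed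

text \<open>If \<^const>\<open>A\<close> is integrable, then its Fourier integral is continuous and is the pointwise limit of
  the integrals over squares. These tend to \<^const>\<open>W\<close> in $L^2$, so by Fatou's lemma the two functions agree
  almost everywhere, hence everywhere once \<^const>\<open>W\<close> is continuous.\<close>

lemma fourier2_A_eq_W:
  assumes int: "integrable lebesgue (\<lambda>(\<tau>, z). A \<tau> z)"
    and cont: "continuous_on UNIV (\<lambda>(t, u). W t u)"
  shows "(LINT (\<tau>, z)|lebesgue. A \<tau> z * exp (\<i> * of_real ((z * t - u * \<tau>) * c))) = W t u"
proof -
  define F where "F t u = (LINT (\<tau>, z)|(lborel \<Otimes>\<^sub>M lborel). A \<tau> z * exp (\<i> * of_real ((z * t - u * \<tau>) * c)))" for t u
  have int': "integrable (lborel \<Otimes>\<^sub>M lborel) (\<lambda>p. A (fst p) (snd p))"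
    using int by (subst (asm) integral_lebesgue_pair) (auto simp: case_prod_unfold)
  have F_cont: "continuous_on UNIV (case_prod F)"
  proof (rule continuous_on_sequentiallyI)
    fix p :: "nat \<Rightarrow> real \<times> real" and a assume p: "p \<longlonglongrightarrow> a"
    show "(\<lambda>n. case_prod F (p n)) \<longlonglongrightarrow> case_prod F a"
      unfolding F_def case_prod_unfold
    proof (rule integral_dominated_convergence[where w = "\<lambda>q. norm (A (fst q) (snd q))"])
      show "AE q in lborel \<Otimes>\<^sub>M lborel. (\<lambda>n. A (fst q) (snd q) * exp (\<i> * of_real ((snd q * fst (p n) - snd (p n) * fst q) * c)))
         \<longlonglongrightarrow> A (fst q) (snd q) * exp (\<i> * of_real ((snd q * fst a - snd a * fst q) * c))"
        by (intro AE_I2 tendsto_intros p)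
    qed (use int' in \<open>auto simp: norm_mult\<close>)
  qed
  then have [measurable]: "case_prod F \<in> borel_measurable (borel \<Otimes>\<^sub>M borel)"
    unfolding borel_prod by (rule borel_measurable_continuous_onI)
  have lim: "(\<lambda>n. T (real n) t u) \<longlonglongrightarrow> F t u" for t u
    unfolding T_eq F_def case_prod_unfold
  proof (rule integral_dominated_convergence[where w = "\<lambda>q. norm (A (fst q) (snd q))"])
    show "AE q in lborel \<Otimes>\<^sub>M lborel. (\<lambda>n. indicator ({-real n..real n} \<times> {-real n..real n}) (fst q, snd q) * A (fst q) (snd q)
        * exp (\<i> * of_real ((snd q * t - u * fst q) * c))) \<longlonglongrightarrow> A (fst q) (snd q) * exp (\<i> * of_real ((snd q * t - u * fst q) * c))"
    proof (rule AE_I2)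
      fix q :: "real \<times> real"
      obtain N where N: "real N \<ge> max \<bar>fst q\<bar> \<bar>snd q\<bar>" using real_arch_simple by blast
      have "indicator ({-real n..real n} \<times> {-real n..real n}) (fst q, snd q) = (1::complex)" if "n \<ge> N" for n
      proof -
        have "real n \<ge> real N" using that by simp
        then show ?thesis using N by (cases q) (auto simp: indicator_def)
      qed
      then have "eventually (\<lambda>n. indicator ({-real n..real n} \<times> {-real n..real n}) (fst q, snd q) * A (fst q) (snd q)
        * exp (\<i> * of_real ((snd q * t - u * fst q) * c)) = A (fst q) (snd q) * exp (\<i> * of_real ((snd q * t - u * fst q) * c))) sequentially"
        by (intro eventually_sequentiallyI[of N]) simp
      then show "(\<lambda>n. indicator ({-real n..real n} \<times> {-real n..real n}) (fst q, snd q) * A (fst q) (snd q)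
        * exp (\<i> * of_real ((snd q * t - u * fst q) * c))) \<longlonglongrightarrow> A (fst q) (snd q) * exp (\<i> * of_real ((snd q * t - u * fst q) * c))"
        by (rule tendsto_eventually)
    qed
  qed (use int' in \<open>auto simp: norm_mult indicator_def\<close>)
  let ?e = "\<lambda>n p. ennreal ((norm (T (real n) (fst p) (snd p) - W (fst p) (snd p)))\<^sup>2)"
  have "(\<integral>\<^sup>+p. ennreal ((norm (F (fst p) (snd p) - W (fst p) (snd p)))\<^sup>2) \<partial>(lborel \<Otimes>\<^sub>M lborel))
     = (\<integral>\<^sup>+p. liminf (\<lambda>n. ?e n p) \<partial>(lborel \<Otimes>\<^sub>M lborel))"
  proof (rule nn_integral_cong)
    fix p
    have "(\<lambda>n. ?e n p) \<longlonglongrightarrow> ennreal ((norm (F (fst p) (snd p) - W (fst p) (snd p)))\<^sup>2)"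
      by (intro tendsto_intros lim)
    then show "ennreal ((norm (F (fst p) (snd p) - W (fst p) (snd p)))\<^sup>2) = liminf (\<lambda>n. ?e n p)"
      by (rule lim_imp_Liminf[OF sequentially_bot, symmetric])
  qed
  also have "\<dots> \<le> liminf (\<lambda>n. \<integral>\<^sup>+p. ?e n p \<partial>(lborel \<Otimes>\<^sub>M lborel))"
    by (rule nn_integral_liminf) measurable
  also have "\<dots> \<le> liminf (\<lambda>n. err (real n))"
  proof (intro Liminf_mono always_eventually allI)
    fix n
    have "(\<integral>\<^sup>+p. ?e n p \<partial>(lborel \<Otimes>\<^sub>M lborel)) = (\<integral>\<^sup>+t. sqnorm (\<lambda>u. T (real n) t u - W t u) \<partial>lborel)"
      using nn_integral_pair_sqnorm[of "\<lambda>t u. T (real n) t u - W t u"] by (simp add: case_prod_unfold)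
    then show "(\<integral>\<^sup>+p. ?e n p \<partial>(lborel \<Otimes>\<^sub>M lborel)) \<le> err (real n)" using err_bound by simp
  qed
  also have "\<dots> = 0"
    using lim_imp_Liminf[OF _ err_tendsto_0[OF filterlim_real_sequentially]] by simp
  finally have "(\<integral>\<^sup>+p. ennreal ((norm (F (fst p) (snd p) - W (fst p) (snd p)))\<^sup>2) \<partial>(lborel \<Otimes>\<^sub>M lborel)) = 0" by simp
  then have "AE p in lborel \<Otimes>\<^sub>M lborel. F (fst p) (snd p) = W (fst p) (snd p)"
    by (subst (asm) nn_integral_0_iff_AE) auto
  then have ae: "AE p in lebesgue. p \<in> {p. case_prod F p = case_prod W p}"
    unfolding lborel_prod by (simp add: AE_completion_iff case_prod_unfold)
  have "closed {p. case_prod F p = case_prod W p}"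
    by (rule closed_Collect_eq) (use F_cont cont in auto)
  from mem_closed_if_AE_lebesgue[OF this ae, of "(t, u)"] have "F t u = W t u" by simp
  moreover have "(LINT (\<tau>, z)|lebesgue. A \<tau> z * exp (\<i> * of_real ((z * t - u * \<tau>) * c))) = F t u"
    unfolding F_def by (rule integral_lebesgue_pair) measurable
  ultimately show ?thesis by simp
qed

end

section \<open>Ambiguity function and Wigner distribution\<close>

text \<open>The product $x(t + k\tau/2)\,\overline{x(t - k\tau/2)}\,e^{i t k \tau a}$. With $a = \cot\theta$, its Fourier transform
  in $t$ is the ambiguity function, and its Fourier transform in $\tau$ is the scaled Wigner distribution.\<close>

definition chirp_product :: "real \<Rightarrow> real \<Rightarrow> (real \<Rightarrow> complex) \<Rightarrow> real \<Rightarrow> real \<Rightarrow> complex" where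
  "chirp_product k a x t \<tau> =
     x (t + k * \<tau> / 2) * cnj (x (t - k * \<tau> / 2)) * exp (\<i> * of_real (t * k * \<tau> * a))"

lemma chirp_product_measurable [measurable]:
  assumes [measurable]: "x \<in> borel_measurable borel"
  shows "case_prod (chirp_product k a x) \<in> borel_measurable (borel \<Otimes>\<^sub>M borel)"
  unfolding chirp_product_def by measurable

lemma norm_chirp_product: "norm (chirp_product k a x t \<tau>) = norm (x (t + k * \<tau> / 2)) * norm (x (t - k * \<tau> / 2))"
  by (simp add: chirp_product_def norm_mult)

lemma integrable_shift_product:
  assumes [measurable]: "x \<in> borel_measurable borel" and fin: "sqnorm x < \<infinity>" and "b \<noteq> 0" "d \<noteq> 0"
  shows "integrable lborel (\<lambda>s. x (r + b * s) * cnj (x (q + d * s)))"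
  by (intro integrable_mult_sqnorm)
    (use assms in \<open>auto simp: sqnorm_cnj sqnorm_affine ennreal_mult_less_top\<close>)

lemma sqnorm_chirp_product:
  assumes [measurable]: "x \<in> borel_measurable borel" and k: "k > 0"
  shows "(\<integral>\<^sup>+t. sqnorm (chirp_product k a x t) \<partial>lborel) = sqnorm x * (ennreal (1 / k) * sqnorm x)"
proof -
  let ?x = "\<lambda>s. ennreal ((norm (x s))\<^sup>2)"
  have "(\<integral>\<^sup>+t. sqnorm (chirp_product k a x t) \<partial>lborel)
      = (\<integral>\<^sup>+t. \<integral>\<^sup>+\<tau>. ?x (t + k * \<tau> / 2) * ?x (t - k * \<tau> / 2) \<partial>lborel \<partial>lborel)"
    unfolding sqnorm_def norm_chirp_product by (simp add: power_mult_distrib ennreal_mult)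
  also have "\<dots> = (\<integral>\<^sup>+\<tau>. \<integral>\<^sup>+t. ?x (t + k * \<tau> / 2) * ?x (t - k * \<tau> / 2) \<partial>lborel \<partial>lborel)"
    by (rule lborel_pair.Fubini'[symmetric]) measurable
  also have "\<dots> = (\<integral>\<^sup>+\<tau>. \<integral>\<^sup>+t. ?x (t + k * \<tau>) * ?x t \<partial>lborel \<partial>lborel)"
  proof (rule nn_integral_cong)
    fix \<tau>
    show "(\<integral>\<^sup>+t. ?x (t + k * \<tau> / 2) * ?x (t - k * \<tau> / 2) \<partial>lborel) = (\<integral>\<^sup>+t. ?x (t + k * \<tau>) * ?x t \<partial>lborel)"
      by (subst nn_integral_real_affine[where c = 1 and t = "k * \<tau> / 2"]) (auto simp: algebra_simps)
  qed
  also have "\<dots> = (\<integral>\<^sup>+t. \<integral>\<^sup>+\<tau>. ?x (t + k * \<tau>) * ?x t \<partial>lborel \<partial>lborel)"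
    by (rule lborel_pair.Fubini') measurable
  also have "\<dots> = (\<integral>\<^sup>+t. ?x t * (ennreal (1 / k) * sqnorm x) \<partial>lborel)"
  proof (rule nn_integral_cong)
    fix t
    have "(\<integral>\<^sup>+\<tau>. ?x (t + k * \<tau>) * ?x t \<partial>lborel) = sqnorm (\<lambda>\<tau>. x (t + k * \<tau>)) * ?x t"
      unfolding sqnorm_def by (rule nn_integral_multc) measurable
    also have "sqnorm (\<lambda>\<tau>. x (t + k * \<tau>)) = ennreal (1 / k) * sqnorm x"
      using k by (simp add: sqnorm_affine)
    also have "\<dots> * ?x t = ?x t * (ennreal (1 / k) * sqnorm x)" by (rule mult.commute)
    finally show "(\<integral>\<^sup>+\<tau>. ?x (t + k * \<tau>) * ?x t \<partial>lborel) = ?x t * (ennreal (1 / k) * sqnorm x)" .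
  qed
  also have "\<dots> = sqnorm x * (ennreal (1 / k) * sqnorm x)"
    unfolding sqnorm_def by (rule nn_integral_multc) measurable
  finally show ?thesis .
qed

lemma partial_fourier_chirp_product:
  assumes [measurable]: "x \<in> borel_measurable borel" and fin: "sqnorm x < \<infinity>" and k: "k > 0" and c: "c \<noteq> 0"
  shows "partial_fourier (chirp_product k a x) c"
proof
  show "(\<integral>\<^sup>+t. sqnorm (chirp_product k a x t) \<partial>lborel) < \<infinity>"
    using fin k by (simp add: sqnorm_chirp_product ennreal_mult_less_top)
  show "integrable lborel (chirp_product k a x t)" for t
    unfolding chirp_product_def[abs_def]
    using integrable_mult_exp[OF integrable_shift_product[OF assms(1) fin, of "k / 2" "- k / 2" t t], of "\<lambda>\<tau>. t * k * \<tau> * a"] k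
    by simp
  show "integrable lborel (\<lambda>t. chirp_product k a x t \<tau>)" for \<tau>
    unfolding chirp_product_def
    using integrable_mult_exp[OF integrable_shift_product[OF assms(1) fin, of 1 1 "k * \<tau> / 2" "- k * \<tau> / 2"], of "\<lambda>t. t * k * \<tau> * a"]
    by (simp add: add.commute)
qed (use c in measurable)

text \<open>The Wigner distribution of a square-integrable function is continuous: the product of the two shifted
  copies varies continuously in $L^1$, and the oscillating factor is handled by dominated convergence.\<close>

lemma continuous_on_fourier_chirp_product:
  assumes [measurable]: "x \<in> borel_measurable borel" and fin: "sqnorm x < \<infinity>" and k: "k > 0"
  shows "continuous_on UNIV (\<lambda>(t, u). fourier c (chirp_product k a x t) u)"
proof (rule continuous_on_sequentiallyI)
  fix p :: "nat \<Rightarrow> real \<times> real" and q assume p: "p \<longlonglongrightarrow> q"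
  define g where "g t \<tau> = x (t + k / 2 * \<tau>) * cnj (x (t + (- k / 2) * \<tau>))" for t \<tau>
  define e where "e s \<tau> = exp (\<i> * of_real ((fst s * k * a + c * snd s) * \<tau>))" for s \<tau>
  have [measurable]: "g t \<in> borel_measurable borel" "e s \<in> borel_measurable borel" for t s
    unfolding g_def[abs_def] e_def[abs_def] by measurable
  have eq: "(case s of (t, u) \<Rightarrow> fourier c (chirp_product k a x t) u) = (LINT \<tau>|lborel. g (fst s) \<tau> * e s \<tau>)" for s
    unfolding fourier_def chirp_product_def case_prod_unfold
  proof (rule Bochner_Integration.integral_cong[OF refl])
    fix \<tau>
    have "exp (\<i> * of_real (fst s * k * \<tau> * a)) * exp (\<i> * of_real (c * \<tau> * snd s)) = e s \<tau>"
      unfolding e_def exp_add[symmetric] by (simp add: algebra_simps)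
    then show "x (fst s + k * \<tau> / 2) * cnj (x (fst s - k * \<tau> / 2)) * exp (\<i> * of_real (fst s * k * \<tau> * a)) *
         exp (\<i> * of_real (c * \<tau> * snd s)) = g (fst s) \<tau> * e s \<tau>"
      by (simp add: g_def mult.assoc)
  qed
  have g_int: "integrable lborel (g t)" for t
    unfolding g_def[abs_def] using k by (intro integrable_shift_product fin) auto
  have ge: "integrable lborel (\<lambda>\<tau>. g t \<tau> * e s \<tau>)" for t s
    unfolding e_def by (intro integrable_mult_exp g_int) measurable
  have norm_e: "norm (e s \<tau>) = 1" for s \<tau> by (simp add: e_def)
  have shift: "(\<lambda>n. sqnorm (\<lambda>\<tau>. x (fst (p n) + b * \<tau>) - x (fst q + b * \<tau>))) \<longlonglongrightarrow> 0" if b: "b \<noteq> 0" for b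
  proof -
    have "sqnorm (\<lambda>\<tau>. x (fst (p n) + b * \<tau>) - x (fst q + b * \<tau>)) = ennreal (1 / \<bar>b\<bar>) * sqnorm (\<lambda>s. x (s + (fst (p n) - fst q)) - x s)" for n
      using sqnorm_affine[of "\<lambda>s. x (s + (fst (p n) - fst q)) - x s" b "fst q"] b by (simp add: algebra_simps)
    moreover have "(\<lambda>n. sqnorm (\<lambda>s. x (s + (fst (p n) - fst q)) - x s)) \<longlonglongrightarrow> 0"
      using tendsto_diff[OF tendsto_fst[OF p] tendsto_const[of "fst q"]]
      by (intro sqnorm_translate_tendsto_0 fin) auto
    ultimately show ?thesis by (simp add: tendsto_0_mult_left_ennreal)
  qed
  have fin': "sqnorm (\<lambda>\<tau>. x (t + b * \<tau>)) < \<infinity>" if "b \<noteq> 0" for t b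
    using that fin by (simp add: sqnorm_affine ennreal_mult_less_top)
  have cnj_shift: "sqnorm (\<lambda>\<tau>. cnj (x (r + b * \<tau>)) - cnj (x (s + b * \<tau>))) = sqnorm (\<lambda>\<tau>. x (r + b * \<tau>) - x (s + b * \<tau>))" for r s b
    using sqnorm_cnj[of "\<lambda>\<tau>. x (r + b * \<tau>) - x (s + b * \<tau>)"] by simp
  have L1: "(\<lambda>n. \<integral>\<^sup>+\<tau>. ennreal (norm (g (fst (p n)) \<tau> - g (fst q) \<tau>)) \<partial>lborel) \<longlonglongrightarrow> 0"
    unfolding g_def
  proof (rule mult_tendsto_L1)
    show "(\<lambda>n. sqnorm (\<lambda>\<tau>. x (fst (p n) + k / 2 * \<tau>) - x (fst q + k / 2 * \<tau>))) \<longlonglongrightarrow> 0"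
      using k by (intro shift) simp
    show "(\<lambda>n. sqnorm (\<lambda>\<tau>. cnj (x (fst (p n) + (- k / 2) * \<tau>)) - cnj (x (fst q + (- k / 2) * \<tau>)))) \<longlonglongrightarrow> 0"
      unfolding cnj_shift using k by (intro shift) simp
    show "sqnorm (\<lambda>\<tau>. x (fst q + k / 2 * \<tau>)) < \<infinity>" using k by (intro fin') simp
    show "sqnorm (\<lambda>\<tau>. cnj (x (fst q + (- k / 2) * \<tau>))) < \<infinity>" unfolding sqnorm_cnj using k by (intro fin') simp
  qed measurable
  have 1: "(\<lambda>n. LINT \<tau>|lborel. g (fst (p n)) \<tau> * e (p n) \<tau> - g (fst q) \<tau> * e (p n) \<tau>) \<longlonglongrightarrow> integral\<^sup>L lborel (\<lambda>\<tau>::real. 0)"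
  proof (rule tendsto_L1_int)
    have "norm (g (fst (p n)) \<tau> * e (p n) \<tau> - g (fst q) \<tau> * e (p n) \<tau> - 0) = norm (g (fst (p n)) \<tau> - g (fst q) \<tau>)" for n \<tau>
      by (simp add: norm_mult norm_e flip: left_diff_distrib)
    then show "(\<lambda>n. \<integral>\<^sup>+\<tau>. ennreal (norm (g (fst (p n)) \<tau> * e (p n) \<tau> - g (fst q) \<tau> * e (p n) \<tau> - 0)) \<partial>lborel) \<longlonglongrightarrow> 0"
      using L1 by simp
  qed (use ge in auto)
  have 2: "(\<lambda>n. LINT \<tau>|lborel. g (fst q) \<tau> * e (p n) \<tau>) \<longlonglongrightarrow> (LINT \<tau>|lborel. g (fst q) \<tau> * e q \<tau>)"
  proof (rule integral_dominated_convergence[where w = "\<lambda>\<tau>. norm (g (fst q) \<tau>)"])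
    show "AE \<tau> in lborel. (\<lambda>n. g (fst q) \<tau> * e (p n) \<tau>) \<longlonglongrightarrow> g (fst q) \<tau> * e q \<tau>"
      unfolding e_def by (intro AE_I2 tendsto_intros p)
  qed (use g_int in \<open>auto simp: norm_mult norm_e\<close>)
  have "(\<lambda>n. (LINT \<tau>|lborel. g (fst (p n)) \<tau> * e (p n) \<tau> - g (fst q) \<tau> * e (p n) \<tau>) + (LINT \<tau>|lborel. g (fst q) \<tau> * e (p n) \<tau>))
     \<longlonglongrightarrow> (LINT \<tau>|lborel. g (fst q) \<tau> * e q \<tau>)"
    using tendsto_add[OF 1 2] by simp
  then show "(\<lambda>n. case p n of (t, u) \<Rightarrow> fourier c (chirp_product k a x t) u) \<longlonglongrightarrow> (case q of (t, u) \<Rightarrow> fourier c (chirp_product k a x t) u)"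
    unfolding eq by (simp add: Bochner_Integration.integral_diff[OF ge ge])
qed

lemma norm_Omega:
  assumes "sin \<theta> \<noteq> 0"
  shows "(norm (Omega \<theta>))\<^sup>2 = \<bar>csc \<theta>\<bar> / (2 * pi)"
proof -
  have "(norm (Omega \<theta>))\<^sup>2 = norm ((1 - \<i> * of_real (cot \<theta>)) / of_real (2 * pi))"
    unfolding Omega_def norm_power[symmetric] power2_csqrt ..
  also have "\<dots> = sqrt (1 + (cot \<theta>)\<^sup>2) / (2 * pi)"
    by (simp only: norm_divide norm_of_real) (simp add: cmod_def)
  also have "1 + (cot \<theta>)\<^sup>2 = (csc \<theta>)\<^sup>2"
    using assms sin_cos_squared_add[of \<theta>] by (simp add: cot_def csc_def field_simps)
  finally show ?thesis by simp
qed

lemma sin_neq_0: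
  assumes "\<forall>n::int. \<theta> \<noteq> of_int n * pi"
  shows "sin \<theta> \<noteq> 0"
  using assms by (simp add: sin_zero_iff_int2)

lemma borel_representative:
  fixes x :: "real \<Rightarrow> complex"
  assumes "x \<in> borel_measurable lebesgue"
  obtains y where "y \<in> borel_measurable borel" "AE s in lborel. x s = y s"
proof -
  have "(\<lambda>s. Re (x s)) \<in> borel_measurable lebesgue" "(\<lambda>s. Im (x s)) \<in> borel_measurable lebesgue"
    using assms by measurable
  from this[THEN completion_ex_borel_measurable_real]
  obtain u v where [measurable]: "u \<in> borel_measurable lborel" "v \<in> borel_measurable lborel"
    and ae: "AE s in lborel. Re (x s) = u s" "AE s in lborel. Im (x s) = v s" by blast
  show thesis
  proof
    show "(\<lambda>s. of_real (u s) + \<i> * of_real (v s)) \<in> borel_measurable borel" by measurable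
    from ae show "AE s in lborel. x s = of_real (u s) + \<i> * of_real (v s)"
      by eventually_elim (simp add: complex_eq_iff)
  qed
qed

lemma AE_affine:
  fixes b :: real
  assumes "AE s in lborel. P s" "b \<noteq> 0"
  shows "AE s in lborel. P (r + b * s)"
proof -
  obtain N where N: "{s. \<not> P s} \<subseteq> N" "N \<in> null_sets lborel"
    using assms(1) by (auto simp: eventually_ae_filter)
  have "AE s in lborel. r + b * s \<notin> N"
  proof (rule AE_borel_affine[OF assms(2)])
    show "Measurable.pred borel (\<lambda>s. s \<notin> N)" using N by auto
    show "AE s in lborel. s \<notin> N" using N by (intro AE_not_in)
  qed
  then show ?thesis by eventually_elim (use N in auto)
qed

text \<open>The integrals defining the ambiguity function and the Wigner distribution see \<open>x\<close> only up to null sets,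
  at every single point; a Lebesgue measurable \<open>x\<close> may thus be replaced by a Borel function.\<close>

lemma integral_shift_product_cong:
  fixes x y h :: "real \<Rightarrow> complex"
  assumes [measurable]: "y \<in> borel_measurable borel" "h \<in> borel_measurable borel"
    and ae: "AE s in lborel. x s = y s" and "b \<noteq> 0" "d \<noteq> 0"
  shows "(LINT s|lebesgue. x (r + b * s) * cnj (x (q + d * s)) * h s) =
    (LINT s|lborel. y (r + b * s) * cnj (y (q + d * s)) * h s)"
proof -
  let ?y = "\<lambda>s. y (r + b * s) * cnj (y (q + d * s)) * h s"
  have y: "?y \<in> borel_measurable lborel" by measurable
  have "AE s in lborel. ?y s = x (r + b * s) * cnj (x (q + d * s)) * h s"
    using AE_affine[OF ae \<open>b \<noteq> 0\<close>, of r] AE_affine[OF ae \<open>d \<noteq> 0\<close>, of q] by eventually_elim simp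
  then have ae': "AE s in lebesgue. ?y s = x (r + b * s) * cnj (x (q + d * s)) * h s"
    by (rule AE_completion)
  have "(LINT s|lebesgue. x (r + b * s) * cnj (x (q + d * s)) * h s) = integral\<^sup>L lebesgue ?y"
  proof (rule integral_cong_AE)
    show "?y \<in> borel_measurable lebesgue" using y by (rule measurable_completion)
    from borel_measurable_AE[OF this ae']
    show "(\<lambda>s. x (r + b * s) * cnj (x (q + d * s)) * h s) \<in> borel_measurable lebesgue" .
  qed (use ae' in \<open>auto elim: eventually_mono\<close>)
  also have "\<dots> = integral\<^sup>L lborel ?y" by (rule integral_completion[OF y])
  finally show ?thesis .
qed

lemma NFrAF_eq:
  assumes [measurable]: "y \<in> borel_measurable borel" and ae: "AE s in lborel. x s = y s"
  shows "NFrAF \<theta> k x \<tau> u = of_real ((norm (Omega \<theta>))\<^sup>2) * fourier (- csc \<theta>) (\<lambda>t. chirp_product k (cot \<theta>) y t \<tau>) u"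
proof -
  have "(LINT t|lebesgue. x (t + k * \<tau> / 2) * cnj (x (t - k * \<tau> / 2)) * exp (\<i> * of_real (t * (k * \<tau> * cot \<theta> - u * csc \<theta>))))
      = (LINT t|lborel. y (k * \<tau> / 2 + 1 * t) * cnj (y (- k * \<tau> / 2 + 1 * t)) * exp (\<i> * of_real (t * (k * \<tau> * cot \<theta> - u * csc \<theta>))))"
    using integral_shift_product_cong[OF assms(1) _ ae, of "\<lambda>t. exp (\<i> * of_real (t * (k * \<tau> * cot \<theta> - u * csc \<theta>)))" 1 1 "k * \<tau> / 2" "- k * \<tau> / 2"]
    by (simp add: add.commute)
  also have "\<dots> = fourier (- csc \<theta>) (\<lambda>t. chirp_product k (cot \<theta>) y t \<tau>) u"
    unfolding fourier_def
  proof (rule Bochner_Integration.integral_cong[OF refl])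
    fix t
    have "exp (\<i> * of_real (t * (k * \<tau> * cot \<theta> - u * csc \<theta>))) =
        exp (\<i> * of_real (t * k * \<tau> * cot \<theta>)) * exp (\<i> * of_real (- csc \<theta> * t * u))"
      unfolding exp_add[symmetric] by (simp add: algebra_simps)
    then show "y (k * \<tau> / 2 + 1 * t) * cnj (y (- k * \<tau> / 2 + 1 * t)) * exp (\<i> * of_real (t * (k * \<tau> * cot \<theta> - u * csc \<theta>)))
       = chirp_product k (cot \<theta>) y t \<tau> * exp (\<i> * of_real (- csc \<theta> * t * u))"
      by (simp add: chirp_product_def add.commute mult.assoc)
  qed
  finally show ?thesis unfolding NFrAF_def by simp
qed

lemma FrSWD_eq:
  assumes [measurable]: "y \<in> borel_measurable borel" and ae: "AE s in lborel. x s = y s" and k: "k > 0"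
  shows "FrSWD \<theta> k x t u = of_real ((norm (Omega \<theta>))\<^sup>2) * fourier (- csc \<theta>) (chirp_product k (cot \<theta>) y t) u"
proof -
  have "(LINT \<tau>|lebesgue. x (t + k * \<tau> / 2) * cnj (x (t - k * \<tau> / 2)) * exp (\<i> * of_real (\<tau> * (k * t * cot \<theta> - u * csc \<theta>))))
      = (LINT \<tau>|lborel. y (t + k / 2 * \<tau>) * cnj (y (t + - k / 2 * \<tau>)) * exp (\<i> * of_real (\<tau> * (k * t * cot \<theta> - u * csc \<theta>))))"
    using integral_shift_product_cong[OF assms(1) _ ae, of "\<lambda>\<tau>. exp (\<i> * of_real (\<tau> * (k * t * cot \<theta> - u * csc \<theta>)))" "k / 2" "- k / 2" t t] k
    by simp
  also have "\<dots> = fourier (- csc \<theta>) (chirp_product k (cot \<theta>) y t) u"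
    unfolding fourier_def
  proof (rule Bochner_Integration.integral_cong[OF refl])
    fix \<tau>
    have "exp (\<i> * of_real (\<tau> * (k * t * cot \<theta> - u * csc \<theta>))) =
        exp (\<i> * of_real (t * k * \<tau> * cot \<theta>)) * exp (\<i> * of_real (- csc \<theta> * \<tau> * u))"
      unfolding exp_add[symmetric] by (simp add: algebra_simps)
    then show "y (t + k / 2 * \<tau>) * cnj (y (t + - k / 2 * \<tau>)) * exp (\<i> * of_real (\<tau> * (k * t * cot \<theta> - u * csc \<theta>)))
       = chirp_product k (cot \<theta>) y t \<tau> * exp (\<i> * of_real (- csc \<theta> * \<tau> * u))"
      by (simp add: chirp_product_def mult.assoc)
  qed
  finally show ?thesis unfolding FrSWD_def by simp
qed

theorem theorem2p1:
  fixes x :: "real \<Rightarrow> complex" and k \<theta> :: real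
  assumes "x \<in> L2"
    and "k \<in> \<rat>" and "k > 0"
    and "\<forall>n::int. \<theta> \<noteq> of_int n * pi"
  shows "has_L2_fourier2 \<theta> (NFrAF \<theta> k x)
           (\<lambda>t u. 1 / of_real ((norm (Omega \<theta>))\<^sup>2) * FrSWD \<theta> k x t u) \<and>
         (integrable lebesgue (\<lambda>(\<tau>, z). NFrAF \<theta> k x \<tau> z) \<longrightarrow>
           (\<forall>t u. (LINT (\<tau>, z)|lebesgue. NFrAF \<theta> k x \<tau> z *
                      exp (\<i> * of_real ((z * t - u * \<tau>) * csc \<theta>))) =
                  1 / of_real ((norm (Omega \<theta>))\<^sup>2) * FrSWD \<theta> k x t u))"
proof -
  have sin: "sin \<theta> \<noteq> 0" by (rule sin_neq_0[OF assms(4)])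
  then have c: "csc \<theta> \<noteq> 0" by (simp add: csc_def)
  have x: "x \<in> borel_measurable lebesgue" "integrable lebesgue (\<lambda>s. (norm (x s))\<^sup>2)"
    using \<open>x \<in> L2\<close> by (auto simp: L2_def)
  obtain y where y [measurable]: "y \<in> borel_measurable borel" and ae: "AE s in lborel. x s = y s"
    using borel_representative[OF x(1)] .
  have "sqnorm y = (\<integral>\<^sup>+s. ennreal ((norm (x s))\<^sup>2) \<partial>lborel)"
    unfolding sqnorm_def using ae by (intro nn_integral_cong_AE) (auto elim: eventually_mono)
  also have "\<dots> = (\<integral>\<^sup>+s. ennreal ((norm (x s))\<^sup>2) \<partial>lebesgue)"
    by (rule nn_integral_completion[symmetric])
  also have "\<dots> < \<infinity>" using x(2) unfolding integrable_iff_bounded by simp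
  finally have fin: "sqnorm y < \<infinity>" .
  interpret partial_fourier "chirp_product k (cot \<theta>) y" "csc \<theta>"
    by (rule partial_fourier_chirp_product[OF y fin \<open>k > 0\<close> c])
  have A: "NFrAF \<theta> k x = A"
    by (intro ext) (simp add: NFrAF_eq[OF y ae] A_def norm_Omega[OF sin] \<kappa>_def)
  have Omega: "(norm (Omega \<theta>))\<^sup>2 \<noteq> 0" using c by (simp add: norm_Omega[OF sin])
  have W: "(\<lambda>t u. 1 / of_real ((norm (Omega \<theta>))\<^sup>2) * FrSWD \<theta> k x t u) = W"
    using Omega by (intro ext) (simp add: FrSWD_eq[OF y ae \<open>k > 0\<close>] W_def)
  have cont: "continuous_on UNIV (\<lambda>(t, u). W t u)"
    unfolding W_def by (rule continuous_on_fourier_chirp_product[OF y fin \<open>k > 0\<close>])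
  show ?thesis
    unfolding A W fun_cong[OF fun_cong[OF W]]
    using has_L2_fourier2_A[OF refl] fourier2_A_eq_W[OF _ cont] by blast
qed

end
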